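(* Let $n\ge 1$ and $\gamma>0$. Let $f,g$ be analytic functions on $\mathbb{B}_n$ and $\varphi,\psi$ be analytic self-maps of $\mathbb{B}_n$. Then $W_{f,\varphi}$ and $W_{g,\psi}$ are non-zero bounded operators on $H_{\gamma}$ and $W^{*}_{g,\psi}=W_{f,\varphi}$ if and only if there are vectors $c,d$ in $\mathbb{B}_n$, a linear operator $A$ on $\mathbb{C}^n$ and a non-zero complex number $\alpha$ such that $$\varphi(z)=\frac{d+Az}{1-\langle z,c\rangle}\quad\text{and}\quad\psi(z)=\frac{c+A^{*}z}{1-\langle z,d\rangle}\quad\text{for all } z\in\mathbb{B}_n,$$ and $f=\alpha K^{\gamma}_{c}=\alpha K^{\gamma}_{\psi(0)}$, $g=\overline{\alpha}K^{\gamma}_{d}=\overline{\alpha}K^{\gamma}_{\varphi(0)}$. In particular, in this case the maps $\varphi$ and $\psi$ are linear fractional maps.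
   Context: $\mathbb{B}_n$ is the open unit ball of $\mathbb{C}^n$, with $\langle z,w\rangle=\sum_j z_j\overline{w_j}$. For $\gamma>0$, $H_{\gamma}$ is the Hilbert space of analytic functions on $\mathbb{B}_n$ with reproducing kernel $K^{\gamma}_z(w)=(1-\langle w,z\rangle)^{-\gamma}$ (principal branch). For $f$ analytic on $\mathbb{B}_n$ and $\varphi$ an analytic self-map of $\mathbb{B}_n$, $W_{f,\varphi}h=f\cdot(h\circ\varphi)$; it is bounded on $H_\gamma$ if it maps $H_\gamma$ into $H_\gamma$ as a bounded operator. A linear fractional map is a map of the form $z\mapsto (Az+B)/(\langle z,C\rangle+d)$ with $A$ a linear operator on $\mathbb{C}^n$, $B,C\in\mathbb{C}^n$ and $d\in\mathbb{C}$. *)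

theory Defs
  imports "HOL-Analysis.Analysis"
begin

section \<open>The unit ball of complex n-space\<close>

text \<open>
  Complex n-space is the type \<open>complex ^ 'n\<close>, with \<open>n = CARD('n) \<ge> 1\<close>. Its library norm is the
  Euclidean one, so \<open>ball 0 1\<close> is the open unit ball. The library inner product on this type is
  the real part of \<open>hinner\<close>.
\<close>

definition hinner :: "complex ^ 'n \<Rightarrow> complex ^ 'n \<Rightarrow> complex" where
  "hinner z w = (\<Sum>j\<in>UNIV. z $ j * cnj (w $ j))"

abbreviation unit_ball :: "(complex ^ 'n) set" where
  "unit_ball \<equiv> ball 0 1"

definition conj_transpose :: "complex ^ 'n ^ 'm \<Rightarrow> complex ^ 'm ^ 'n" where
  "conj_transpose A = (\<chi> i j. cnj (A $ j $ i))"

lemma hinner_conj_transpose: "hinner (A *v z) w = hinner z (conj_transpose A *v w)"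
proof -
  have "hinner (A *v z) w = (\<Sum>i\<in>UNIV. \<Sum>j\<in>UNIV. A $ i $ j * z $ j * cnj (w $ i))"
    by (simp add: hinner_def matrix_vector_mult_def sum_distrib_right)
  also have "\<dots> = (\<Sum>j\<in>UNIV. \<Sum>i\<in>UNIV. A $ i $ j * z $ j * cnj (w $ i))"
    by (rule sum.swap)
  also have "\<dots> = hinner z (conj_transpose A *v w)"
    by (simp add: hinner_def matrix_vector_mult_def conj_transpose_def sum_distrib_left
        mult.assoc mult.left_commute)
  finally show ?thesis .
qed


section \<open>Analytic functions and linear fractional maps\<close>

text \<open>
  On an open set, analyticity is complex differentiability at every point: the Frechet
  derivative exists and is complex linear, that is, of the form \<open>h \<mapsto> \<Sum>i. a\<^sub>i h\<^sub>i\<close>.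
\<close>

definition analytic_fun_on :: "(complex ^ 'n \<Rightarrow> complex) \<Rightarrow> (complex ^ 'n) set \<Rightarrow> bool" where
  "analytic_fun_on f S \<longleftrightarrow>
     (\<forall>z\<in>S. \<exists>a :: complex ^ 'n. (f has_derivative (\<lambda>h. \<Sum>i\<in>UNIV. a $ i * h $ i)) (at z))"

definition analytic_map_on ::
    "(complex ^ 'n \<Rightarrow> complex ^ 'm) \<Rightarrow> (complex ^ 'n) set \<Rightarrow> bool" where
  "analytic_map_on \<phi> S \<longleftrightarrow> (\<forall>i. analytic_fun_on (\<lambda>z. \<phi> z $ i) S)"

definition analytic_self_map_on :: "(complex ^ 'n \<Rightarrow> complex ^ 'n) \<Rightarrow> (complex ^ 'n) set \<Rightarrow> bool" where
  "analytic_self_map_on \<phi> S \<longleftrightarrow> analytic_map_on \<phi> S \<and> \<phi> ` S \<subseteq> S"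

definition linear_fractional_on ::
    "(complex ^ 'n \<Rightarrow> complex ^ 'n) \<Rightarrow> (complex ^ 'n) set \<Rightarrow> bool" where
  "linear_fractional_on \<phi> S \<longleftrightarrow>
     (\<exists>(A :: complex ^ 'n ^ 'n) B C d. \<forall>z\<in>S.
        hinner z C + d \<noteq> 0 \<and> \<phi> z = (1 / (hinner z C + d)) *s (A *v z + B))"


section \<open>Reproducing kernel Hilbert spaces\<close>

text \<open>
  A complex Hilbert space of functions on \<open>X\<close>. HOL functions are total, so functions on \<open>X\<close> are
  represented by their extensions by zero; two elements of \<open>H\<close> are then equal iff they agree
  on \<open>X\<close>. The inner product is linear in its first argument.
\<close>

locale hilbert_function_space =
  fixes X :: "'a set"
    and H :: "('a \<Rightarrow> complex) set"
    and ip :: "('a \<Rightarrow> complex) \<Rightarrow> ('a \<Rightarrow> complex) \<Rightarrow> complex"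
  assumes zero_outside: "\<And>h x. h \<in> H \<Longrightarrow> x \<notin> X \<Longrightarrow> h x = 0"
    and zero_closed: "(\<lambda>_. 0) \<in> H"
    and add_closed: "\<And>h k. h \<in> H \<Longrightarrow> k \<in> H \<Longrightarrow> (\<lambda>x. h x + k x) \<in> H"
    and scale_closed: "\<And>c h. h \<in> H \<Longrightarrow> (\<lambda>x. c * h x) \<in> H"
    and ip_add: "\<And>h k l. h \<in> H \<Longrightarrow> k \<in> H \<Longrightarrow> l \<in> H \<Longrightarrow>
           ip (\<lambda>x. h x + k x) l = ip h l + ip k l"
    and ip_scale: "\<And>c h l. h \<in> H \<Longrightarrow> l \<in> H \<Longrightarrow> ip (\<lambda>x. c * h x) l = c * ip h l"
    and ip_cnj: "\<And>h k. h \<in> H \<Longrightarrow> k \<in> H \<Longrightarrow> ip k h = cnj (ip h k)"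
    and ip_nonneg: "\<And>h. h \<in> H \<Longrightarrow> 0 \<le> Re (ip h h)"
    and ip_definite: "\<And>h. h \<in> H \<Longrightarrow> ip h h = 0 \<Longrightarrow> h = (\<lambda>_. 0)"
    and complete: "\<And>s :: nat \<Rightarrow> 'a \<Rightarrow> complex.
           (\<forall>i. s i \<in> H) \<Longrightarrow>
           (\<forall>e>0. \<exists>N. \<forall>i\<ge>N. \<forall>j\<ge>N.
              sqrt (Re (ip (\<lambda>x. s i x - s j x) (\<lambda>x. s i x - s j x))) < e) \<Longrightarrow>
           \<exists>h\<in>H. (\<lambda>i. sqrt (Re (ip (\<lambda>x. s i x - h x) (\<lambda>x. s i x - h x)))) \<longlonglongrightarrow> 0"

locale reproducing_kernel_hilbert_space = hilbert_function_space X H ip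
  for X :: "'a set"
    and H :: "('a \<Rightarrow> complex) set"
    and ip :: "('a \<Rightarrow> complex) \<Rightarrow> ('a \<Rightarrow> complex) \<Rightarrow> complex" +
  fixes K :: "'a \<Rightarrow> 'a \<Rightarrow> complex"
  assumes kernel_closed: "\<And>x. x \<in> X \<Longrightarrow> K x \<in> H"
    and reproducing: "\<And>h x. h \<in> H \<Longrightarrow> x \<in> X \<Longrightarrow> ip h (K x) = h x"

text \<open>
  The kernel \<open>K\<^sub>z(w) = (1 - \<langle>w,z\<rangle>)\<^sup>-\<^sup>\<gamma>\<close>, extended by zero in \<open>w\<close>. On the ball \<open>1 - \<langle>w,z\<rangle>\<close> has positive
  real part, and \<open>powr\<close> on complex numbers uses the principal logarithm.
\<close>

definition ball_kernel :: "real \<Rightarrow> complex ^ 'n \<Rightarrow> complex ^ 'n \<Rightarrow> complex" where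
  "ball_kernel \<gamma> z w = (if w \<in> unit_ball then (1 - hinner w z) powr (- of_real \<gamma>) else 0)"

text \<open>
  \<open>(H, ip)\<close> is the space \<open>H\<^sub>\<gamma>\<close>. A Hilbert function space, with its inner product on \<open>H\<close>, is uniquely
  determined by its reproducing kernel.
\<close>

definition is_H_gamma ::
    "real \<Rightarrow> (complex ^ 'n \<Rightarrow> complex) set \<Rightarrow>
     ((complex ^ 'n \<Rightarrow> complex) \<Rightarrow> (complex ^ 'n \<Rightarrow> complex) \<Rightarrow> complex) \<Rightarrow> bool" where
  "is_H_gamma \<gamma> H ip \<longleftrightarrow>
     reproducing_kernel_hilbert_space unit_ball H ip (ball_kernel \<gamma>) \<and>
     (\<forall>h\<in>H. analytic_fun_on h unit_ball)"


section \<open>Weighted composition operators\<close>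

definition weighted_comp ::
    "(complex ^ 'n \<Rightarrow> complex) \<Rightarrow> (complex ^ 'n \<Rightarrow> complex ^ 'n) \<Rightarrow>
     (complex ^ 'n \<Rightarrow> complex) \<Rightarrow> complex ^ 'n \<Rightarrow> complex" where
  "weighted_comp f \<phi> h = (\<lambda>z. if z \<in> unit_ball then f z * h (\<phi> z) else 0)"

definition bounded_operator_on ::
    "('a \<Rightarrow> complex) set \<Rightarrow> (('a \<Rightarrow> complex) \<Rightarrow> ('a \<Rightarrow> complex) \<Rightarrow> complex) \<Rightarrow>
     (('a \<Rightarrow> complex) \<Rightarrow> ('a \<Rightarrow> complex)) \<Rightarrow> bool" where
  "bounded_operator_on H ip T \<longleftrightarrow>
     (\<forall>h\<in>H. T h \<in> H) \<and>
     (\<forall>h\<in>H. \<forall>k\<in>H. T (\<lambda>x. h x + k x) = (\<lambda>x. T h x + T k x)) \<and>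
     (\<forall>c. \<forall>h\<in>H. T (\<lambda>x. c * h x) = (\<lambda>x. c * T h x)) \<and>
     (\<exists>M. \<forall>h\<in>H. sqrt (Re (ip (T h) (T h))) \<le> M * sqrt (Re (ip h h)))"

definition nonzero_operator_on ::
    "('a \<Rightarrow> complex) set \<Rightarrow> (('a \<Rightarrow> complex) \<Rightarrow> ('a \<Rightarrow> complex)) \<Rightarrow> bool" where
  "nonzero_operator_on H T \<longleftrightarrow> (\<exists>h\<in>H. T h \<noteq> (\<lambda>_. 0))"

text \<open>\<open>S = T\<^sup>*\<close> on \<open>H\<close>, for operators \<open>S\<close> and \<open>T\<close> mapping \<open>H\<close> into itself.\<close>

definition is_adjoint_on ::
    "('a \<Rightarrow> complex) set \<Rightarrow> (('a \<Rightarrow> complex) \<Rightarrow> ('a \<Rightarrow> complex) \<Rightarrow> complex) \<Rightarrow>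
     (('a \<Rightarrow> complex) \<Rightarrow> ('a \<Rightarrow> complex)) \<Rightarrow> (('a \<Rightarrow> complex) \<Rightarrow> ('a \<Rightarrow> complex)) \<Rightarrow> bool" where
  "is_adjoint_on H ip T S \<longleftrightarrow> (\<forall>h\<in>H. \<forall>k\<in>H. ip (T h) k = ip h (S k))"

definition nonzero_bounded_adjoint_pair ::
    "('a \<Rightarrow> complex) set \<Rightarrow> (('a \<Rightarrow> complex) \<Rightarrow> ('a \<Rightarrow> complex) \<Rightarrow> complex) \<Rightarrow>
     (('a \<Rightarrow> complex) \<Rightarrow> ('a \<Rightarrow> complex)) \<Rightarrow> (('a \<Rightarrow> complex) \<Rightarrow> ('a \<Rightarrow> complex)) \<Rightarrow> bool" where
  "nonzero_bounded_adjoint_pair H ip T S \<longleftrightarrow>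
     bounded_operator_on H ip T \<and> nonzero_operator_on H T \<and>
     bounded_operator_on H ip S \<and> nonzero_operator_on H S \<and>
     is_adjoint_on H ip T S"

end

theory Submission
  imports Defs
begin

text \<open>
  Tested on pairs of kernel functions, adjointness of the two operators is the identity
  \<open>g w * K\<^sub>z (\<psi> w) = cnj (f z) * K\<^bsub>\<phi> z\<^esub> w\<close>. Putting \<open>z = 0\<close> and \<open>w = 0\<close> determines \<open>f\<close> and \<open>g\<close>; extracting
  the \<open>\<gamma>\<close>-th root, by continuity of logarithms on the connected ball, leaves the polarised identity
  \<open>(1 - \<langle>w,d\<rangle>) (1 - \<langle>\<psi> w,z\<rangle>) = (1 - \<langle>c,z\<rangle>) (1 - \<langle>w,\<phi> z\<rangle>)\<close>, which makes \<open>(1 - \<langle>z,c\<rangle>) \<phi> z - d\<close> linear in \<open>z\<close>.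

  The converse needs boundedness for every \<open>\<gamma> > 0\<close>. Homogenise \<open>\<phi>\<close> to the linear map
  \<open>(y\<^sub>0, y) \<mapsto> (y\<^sub>0 - \<langle>y,c\<rangle>, y\<^sub>0 d + A y)\<close>, which preserves the cone \<open>|y| < |y\<^sub>0|\<close>; by the S-lemma the pullback of
  the form \<open>|y\<^sub>0|\<^sup>2 - |y|\<^sup>2\<close> dominates \<open>l\<close> times the form for some \<open>l > 0\<close>. In terms of kernels this
  reads \<open>l (1 - \<langle>w,z\<rangle>) = (1 - \<langle>c,z\<rangle>) (1 - \<langle>w,c\<rangle>) (1 - \<langle>\<phi> w,\<phi> z\<rangle>) (1 - S)\<close> with \<open>S\<close> positive semidefinite and
  \<open>|S| < 1\<close>. As \<open>(1 - S) powr -\<gamma> - 1\<close> is then positive semidefinite, the Schur product theorem bounds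
  the operator on the span of the kernels, and the span is dense.
\<close>

section \<open>The Hermitian inner product\<close>

lemma hinner_add_left: "hinner (x + y) z = hinner x z + hinner y z"
  by (simp add: hinner_def distrib_right sum.distrib)

lemma hinner_add_right: "hinner x (y + z) = hinner x y + hinner x z"
  by (simp add: hinner_def distrib_left sum.distrib)

lemma hinner_diff_left: "hinner (x - y) z = hinner x z - hinner y z"
  by (simp add: hinner_def left_diff_distrib sum_subtractf)

lemma hinner_diff_right: "hinner x (y - z) = hinner x y - hinner x z"
  by (simp add: hinner_def right_diff_distrib sum_subtractf)

lemma hinner_minus_right: "hinner x (- y) = - hinner x y"
  by (simp add: hinner_def sum_negf)

lemma hinner_scale_left: "hinner (a *s x) y = a * hinner x y"
  by (simp add: hinner_def sum_distrib_left mult.assoc)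

lemma hinner_scale_right: "hinner x (a *s y) = cnj a * hinner x y"
  by (simp add: hinner_def sum_distrib_left mult_ac)

lemma hinner_scaleR_left: "hinner (t *\<^sub>R x) y = of_real t * hinner x y"
  by (simp add: hinner_def sum_distrib_left scaleR_conv_of_real[where 'a = complex] mult.assoc)

lemma hinner_scaleR_right: "hinner x (t *\<^sub>R y) = of_real t * hinner x y"
  by (simp add: hinner_def sum_distrib_left scaleR_conv_of_real[where 'a = complex] mult_ac)

lemma hinner_zero [simp]: "hinner 0 x = 0" "hinner x 0 = 0"
  by (simp_all add: hinner_def)

lemma hinner_sum_left: "hinner (\<Sum>i\<in>F. x i) y = (\<Sum>i\<in>F. hinner (x i) y)"
  by (induction F rule: infinite_finite_induct) (simp_all add: hinner_add_left)

lemma hinner_sum_right: "hinner y (\<Sum>i\<in>F. x i) = (\<Sum>i\<in>F. hinner y (x i))"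
  by (induction F rule: infinite_finite_induct) (simp_all add: hinner_add_right)

lemma cnj_hinner: "cnj (hinner x y) = hinner y x"
  by (simp add: hinner_def mult.commute)

lemma hinner_self: "hinner x x = of_real ((norm x)\<^sup>2)"
  by (simp add: hinner_def norm_vec_def L2_set_def sum_nonneg complex_norm_square
      flip: of_real_power)

lemma norm_hinner_le: "norm (hinner x y) \<le> norm x * norm y"
proof -
  have "norm (hinner x y) \<le> (\<Sum>j\<in>UNIV. norm (x $ j) * norm (y $ j))"
    unfolding hinner_def by (rule order_trans[OF norm_sum]) (simp add: norm_mult)
  also have "\<dots> = (\<Sum>j\<in>UNIV. \<bar>norm (x $ j)\<bar> * \<bar>norm (y $ j)\<bar>)" by simp
  also have "\<dots> \<le> norm x * norm y"
    unfolding norm_vec_def by (rule L2_set_mult_ineq)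
  finally show ?thesis .
qed

lemma norm_scale_vec: "norm (a *s x) = norm a * norm (x :: complex ^ 'n)"
  by (simp add: norm_vec_def norm_mult L2_set_right_distrib)

lemma continuous_on_hinner [continuous_intros]:
  "continuous_on S u \<Longrightarrow> continuous_on S v \<Longrightarrow> continuous_on S (\<lambda>t. hinner (u t) (v t))"
  unfolding hinner_def by (intro continuous_intros)

lemma hinner_ball_less_1:
  assumes "z \<in> unit_ball" "w \<in> unit_ball"
  shows "norm (hinner z w) < 1"
proof -
  have "norm z * norm w < 1"
    using assms mult_strict_mono[of "norm z" 1 "norm w" 1] by simp
  then show ?thesis using norm_hinner_le[of z w] by simp
qed

lemma Re_one_minus_pos: "norm (u :: complex) < 1 \<Longrightarrow> 0 < Re (1 - u)"
  using complex_Re_le_cmod[of u] by simp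

text \<open>Dividing \<open>u - v\<close> by \<open>1 + norm (u - v)\<close> moves it into the open
  ball, and pairing \<open>u - v\<close> with the result gives a positive multiple of its squared
  norm.\<close>

lemma vec_eqI_hinner_ball:
  fixes u v :: "complex ^ 'n"
  assumes "\<And>z. z \<in> unit_ball \<Longrightarrow> hinner u z = hinner v z"
  shows "u = v"
proof -
  have pos: "0 < 1 + norm (u - v)" by (simp add: add_pos_nonneg)
  have "hinner (u - v) ((1 / (1 + norm (u - v))) *\<^sub>R (u - v)) = 0"
    unfolding hinner_diff_left
    by (subst assms) (use pos in \<open>auto simp: divide_simps\<close>)
  then have "of_real (1 / (1 + norm (u - v)) * (norm (u - v))\<^sup>2) = (0 :: complex)"
    by (simp add: hinner_scaleR_right hinner_self)
  then show ?thesis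
    using pos by (simp only: of_real_eq_0_iff) auto
qed

section \<open>Real quadratic forms\<close>

text \<open>An isotropic \<open>x\<close> is the endpoint of a ray on which \<open>q > 0\<close>,
  and \<open>r\<close> is a polynomial along that ray. \<open>Bq\<close> and \<open>Br\<close> stand
  for the polar forms and enter only through the two expansions.\<close>

lemma quadratic_form_nonneg_boundary:
  fixes q r :: "'v :: real_vector \<Rightarrow> real"
  assumes q: "\<And>x y s. q (x + s *\<^sub>R y) = q x + 2 * s * Bq x y + s\<^sup>2 * q y"
    and r: "\<And>x y s. r (x + s *\<^sub>R y) = r x + 2 * s * Br x y + s\<^sup>2 * r y"
    and pos: "\<And>x. q x > 0 \<Longrightarrow> r x \<ge> 0"
    and e: "q e > 0" and x: "q x = 0"
  shows "r x \<ge> 0"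
proof -
  \<comment> \<open>The sign makes the cross term of \<open>q\<close> nonnegative, so that
    \<open>q\<close> is positive at \<open>x\<close> plus \<sigma> s times \<open>e\<close> for
    every s > 0.\<close>
  define \<sigma> :: real where "\<sigma> = (if Bq x e \<ge> 0 then 1 else - 1)"
  have "r x + 2 * (\<sigma> * s) * Br x e + (\<sigma> * s)\<^sup>2 * r e \<ge> 0" if "s > 0" for s
  proof -
    have "0 < 2 * (\<sigma> * s) * Bq x e + (\<sigma> * s)\<^sup>2 * q e"
    proof -
      have *: "2 * (\<sigma> * s) * Bq x e = 2 * s * \<bar>Bq x e\<bar>" "(\<sigma> * s)\<^sup>2 = s\<^sup>2"
        by (simp_all add: \<sigma>_def)
      show ?thesis
        unfolding * using that e by (simp add: add_nonneg_pos)
    qed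
    then have "q (x + (\<sigma> * s) *\<^sub>R e) > 0" by (simp add: q x)
    from pos[OF this] show ?thesis by (simp add: r)
  qed
  then have ev: "\<forall>\<^sub>F s in at_right 0. 0 \<le> r x + 2 * (\<sigma> * s) * Br x e + (\<sigma> * s)\<^sup>2 * r e"
    by (auto simp: eventually_at_right_less intro: eventually_mono[OF eventually_at_right_less])
  have "((\<lambda>s. r x + 2 * (\<sigma> * s) * Br x e + (\<sigma> * s)\<^sup>2 * r e) \<longlongrightarrow>
         r x + 2 * (\<sigma> * 0) * Br x e + (\<sigma> * 0)\<^sup>2 * r e) (at_right 0)"
    by (intro tendsto_intros)
  from tendsto_lowerbound[OF this ev] show ?thesis by simp
qed

text \<open>A multiplier \<open>l\<close> with \<open>l * q \<le> r\<close> has to lie above the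
  ratios \<open>r / q\<close> where \<open>q < 0\<close> and below those where \<open>q > 0\<close>;
  this comparison leaves room for one.\<close>

lemma quadratic_form_ratio_le:
  fixes q r :: "'v :: real_vector \<Rightarrow> real"
  assumes q: "\<And>x y s. q (x + s *\<^sub>R y) = q x + 2 * s * Bq x y + s\<^sup>2 * q y"
    and r: "\<And>x y s. r (x + s *\<^sub>R y) = r x + 2 * s * Br x y + s\<^sup>2 * r y"
    and nonneg: "\<And>x. q x = 0 \<Longrightarrow> r x \<ge> 0"
    and x: "q x > 0" and y: "q y < 0"
  shows "r y / q y \<le> r x / q x"
proof -
  \<comment> \<open>\<open>x + s y\<close> is isotropic for \<open>q\<close> at two roots \<open>s\<close> of opposite sign; eliminate the cross term
    of \<open>r\<close> between them.\<close>
  define D where "D = sqrt ((Bq x y)\<^sup>2 - q x * q y)"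
  have D2: "D\<^sup>2 = (Bq x y)\<^sup>2 - q x * q y"
    unfolding D_def using x y mult_pos_neg[of "q x" "q y"]
    by (subst real_sqrt_pow2) (auto intro: order_trans[of _ 0])
  have D: "D > \<bar>Bq x y\<bar>"
    unfolding D_def by (rule real_less_rsqrt) (use x y mult_pos_neg[of "q x" "q y"] in auto)
  define u where "u = (- Bq x y + D) / q y"
  define v where "v = (- Bq x y - D) / q y"
  have u: "u < 0" and v: "v > 0"
    using D y by (auto simp: u_def v_def divide_simps)
  have "q y * q (x + s *\<^sub>R y) = q x * q y + 2 * Bq x y * (s * q y) + (s * q y)\<^sup>2" for s
    by (simp add: q algebra_simps power2_eq_square)
  note q_scaled = this
  have uq: "u * q y = - Bq x y + D" and vq: "v * q y = - Bq x y - D"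
    using y by (simp_all add: u_def v_def)
  have "q y * q (x + u *\<^sub>R y) = D\<^sup>2 - ((Bq x y)\<^sup>2 - q x * q y)"
      "q y * q (x + v *\<^sub>R y) = D\<^sup>2 - ((Bq x y)\<^sup>2 - q x * q y)"
    unfolding q_scaled uq vq by (simp_all add: power2_eq_square algebra_simps)
  then have "q (x + u *\<^sub>R y) = 0" "q (x + v *\<^sub>R y) = 0"
    using y D2 by auto
  then have ru: "r x + 2 * u * Br x y + u\<^sup>2 * r y \<ge> 0" and rv: "r x + 2 * v * Br x y + v\<^sup>2 * r y \<ge> 0"
    using nonneg r by metis+
  have "0 \<le> v * (r x + 2 * u * Br x y + u\<^sup>2 * r y) + (- u) * (r x + 2 * v * Br x y + v\<^sup>2 * r y)"
    by (rule add_nonneg_nonneg; rule mult_nonneg_nonneg) (use ru rv u v in auto)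
  also have "\<dots> = (v - u) * (r x - (u * v) * r y)"
    by (simp add: algebra_simps power2_eq_square)
  finally have 1: "0 \<le> r x - (u * v) * r y"
    using u v by (simp add: zero_le_mult_iff)
  \<comment> \<open>The product of the two roots, as in Vieta's formula, turns the inequality into a
    comparison of ratios.\<close>
  have "u * v = ((Bq x y)\<^sup>2 - D\<^sup>2) / (q y)\<^sup>2"
    by (simp add: u_def v_def power2_eq_square field_simps)
  also have "\<dots> = q x / q y"
    unfolding D2 using y by (simp add: power2_eq_square)
  finally have "u * v = q x / q y" .
  with 1 have "0 \<le> r x - q x / q y * r y" by simp
  then have "0 \<le> (r x - q x / q y * r y) / q x" using x by simp
  then show ?thesis using x by (simp add: field_simps)
qed

text \<open>The infimum of \<open>r / q\<close> over \<open>q > 0\<close> serves as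
  \<open>l\<close>. Where \<open>q > 0\<close> it is a lower bound, where \<open>q = 0\<close> the
  boundary lemma applies, and where \<open>q < 0\<close> the comparison of ratios does.\<close>

lemma S_lemma:
  fixes q r :: "'v :: real_vector \<Rightarrow> real"
  assumes q: "\<And>x y s. q (x + s *\<^sub>R y) = q x + 2 * s * Bq x y + s\<^sup>2 * q y"
    and r: "\<And>x y s. r (x + s *\<^sub>R y) = r x + 2 * s * Br x y + s\<^sup>2 * r y"
    and pos: "\<And>x. q x > 0 \<Longrightarrow> r x \<ge> 0"
    and e: "q e > 0"
  obtains l where "l \<ge> 0" "\<And>x. l * q x \<le> r x"
proof -
  let ?R = "(\<lambda>x. r x / q x) ` {x. q x > 0}"
  have bdd: "bdd_below ?R"
    by (rule bdd_belowI[of _ 0]) (auto simp: pos)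
  have ne: "?R \<noteq> {}" using e by auto
  have nonneg: "r x \<ge> 0" if "q x = 0" for x
    using quadratic_form_nonneg_boundary[of q Bq r Br, OF q r pos e that] .
  show thesis
  proof
    show "Inf ?R \<ge> 0" by (rule cInf_greatest[OF ne]) (auto simp: pos)
    fix x
    consider "q x > 0" | "q x = 0" | "q x < 0" by linarith
    then show "Inf ?R * q x \<le> r x"
    proof cases
      case 1
      then have "Inf ?R \<le> r x / q x" by (intro cInf_lower bdd) auto
      then show ?thesis using 1 by (simp add: field_simps)
    next
      case 2
      then show ?thesis using nonneg by simp
    next
      case 3
      have "r x / q x \<le> Inf ?R"
        by (rule cInf_greatest[OF ne])
           (use quadratic_form_ratio_le[of q Bq r Br, OF q r nonneg _ 3] in auto)
      then show ?thesis using 3 by (simp add: field_simps)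
    qed
  qed
qed

text \<open>The self-map property says that the homogenised map preserves the cone, so the S-lemma
  applies to the form and its pullback. The S-lemma alone allows \<open>l = 0\<close>; strict
  positivity matters because \<open>l\<close> is later raised to the power -\<gamma>.\<close>

lemma cone_map_form_bound:
  fixes A :: "complex ^ 'n ^ 'n" and c d :: "complex ^ 'n"
  assumes c: "c \<in> unit_ball" and d: "d \<in> unit_ball"
    and self: "\<And>z. z \<in> unit_ball \<Longrightarrow> norm (d + A *v z) < norm (1 - hinner z c)"
  obtains l where "l > 0"
    "\<And>y0 y. l * ((norm y0)\<^sup>2 - (norm y)\<^sup>2) \<le> (norm (y0 - hinner y c))\<^sup>2 - (norm (y0 *s d + A *v y))\<^sup>2"
proof -
  define q where "q x = (norm (fst x))\<^sup>2 - (norm (snd x))\<^sup>2" for x :: "complex \<times> (complex ^ 'n)"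
  define T1 where "T1 x = fst x - hinner (snd x) c" for x :: "complex \<times> (complex ^ 'n)"
  define T2 where "T2 x = fst x *s d + A *v snd x" for x :: "complex \<times> (complex ^ 'n)"
  define r where "r x = (norm (T1 x))\<^sup>2 - (norm (T2 x))\<^sup>2" for x
  have sq: "(norm (a + s *\<^sub>R b))\<^sup>2 = (norm a)\<^sup>2 + 2 * s * (a \<bullet> b) + s\<^sup>2 * (norm b)\<^sup>2"
    for a b :: "'v :: real_inner" and s
    unfolding power2_norm_eq_inner
    by (simp add: inner_add_left inner_add_right inner_commute power2_eq_square algebra_simps)
  have T1: "T1 (x + s *\<^sub>R y) = T1 x + s *\<^sub>R T1 y" for x y s
    by (simp add: T1_def hinner_add_left hinner_scaleR_left algebra_simps
        scaleR_conv_of_real[where 'a = complex])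
  have T2: "T2 (x + s *\<^sub>R y) = T2 x + s *\<^sub>R T2 y" for x y s
  proof -
    have "A *v (snd x + s *\<^sub>R snd y) = A *v snd x + s *\<^sub>R (A *v snd y)"
      by (simp add: matrix_vector_right_distrib matrix_vector_mult_def vec_eq_iff scaleR_right.sum sum.distrib algebra_simps)
    then show ?thesis
      by (simp add: T2_def vec_eq_iff algebra_simps)
  qed
  have qB: "q (x + s *\<^sub>R y) = q x + 2 * s * (fst x \<bullet> fst y - snd x \<bullet> snd y) + s\<^sup>2 * q y" for x y s
    unfolding q_def by (simp add: sq) (simp add: algebra_simps)
  have rB: "r (x + s *\<^sub>R y) = r x + 2 * s * (T1 x \<bullet> T1 y - T2 x \<bullet> T2 y) + s\<^sup>2 * r y" for x y s
    unfolding r_def T1 T2 by (simp add: sq) (simp add: algebra_simps)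
  have pos: "r x \<ge> 0" if "q x > 0" for x
  proof -
    obtain x0 x' where x: "x = (x0, x')" by force
    from that have lt: "norm x' < norm x0"
      by (simp add: q_def x) (metis abs_le_square_iff abs_norm_cancel linorder_not_le)
    then have x0: "x0 \<noteq> 0" by auto
    \<comment> \<open>Every point of the cone is a multiple of \<open>(1, z)\<close> with
      \<open>z\<close> in the ball, which is where \<open>self\<close> speaks.\<close>
    define z where "z = (1 / x0) *s x'"
    have z: "z \<in> unit_ball" using lt x0 by (simp add: z_def norm_scale_vec norm_divide)
    have x': "x' = x0 *s z" using x0 by (simp add: z_def vec_eq_iff)
    have "T1 x = x0 * (1 - hinner z c)"
      by (simp add: T1_def x x' hinner_scale_left algebra_simps)
    moreover have "T2 x = x0 *s (d + A *v z)"
      by (simp add: T2_def x x' vector_scalar_commute vec_eq_iff algebra_simps)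
    ultimately have "norm (T2 x) \<le> norm (T1 x)"
      using self[OF z] by (simp only: norm_scale_vec norm_mult mult_left_mono less_imp_le norm_ge_zero)
    then show ?thesis by (simp add: r_def)
  qed
  have "q (1, 0) > 0" by (simp add: q_def)
  from S_lemma[of q _ r, OF qB rB pos this]
  obtain l where l: "l \<ge> 0" "\<And>x. l * q x \<le> r x" by blast
  show thesis
  proof (cases "l = 0")
    case False
    show thesis
      by (rule that[of l]) (use l(2) l(1) False in \<open>auto simp: q_def r_def T1_def T2_def split: prod.splits\<close>)
  next
    \<comment> \<open>The pullback is then positive semidefinite, which forces rank one: \<open>(T1, T2)\<close> is the map
      \<open>(y\<^sub>0, y) \<mapsto> (y\<^sub>0 - \<langle>y,c\<rangle>) (1, d)\<close>, and a positive constant can be computed.\<close>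
    case True
    \<comment> \<open>At \<open>(hinner y c, y)\<close> the component \<open>T1\<close> vanishes, so
      there \<open>r\<close> is minus a square, and being nonnegative it is zero.\<close>
    have A: "A *v y = - hinner y c *s d" for y
    proof -
      have "0 \<le> r (hinner y c, y)" using l(2)[of "(hinner y c, y)"] True by simp
      then have "hinner y c *s d + A *v y = 0" by (simp add: r_def T1_def T2_def)
      then show ?thesis by (simp add: vec_eq_iff add_eq_0_iff)
    qed
    \<comment> \<open>The factor with \<open>c\<close> comes from completing the square in the
      estimate below, the factor with \<open>d\<close> from
      \<open>norm (x *s d) = norm x * norm d\<close>.\<close>
    define m where "m = (1 - (norm d)\<^sup>2) * (1 - (norm c)\<^sup>2)"
    have c1: "1 - (norm c)\<^sup>2 > 0" and d1: "1 - (norm d)\<^sup>2 > 0"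
      using c d by (simp_all add: power_less_one_iff)
    show thesis
    proof (rule that[of m])
      show "m > 0" using c1 d1 by (simp add: m_def)
      fix y0 :: complex and y :: "complex ^ 'n"
      define x where "x = y0 - hinner y c"
      have "norm y0 \<le> norm x + norm (hinner y c)"
        unfolding x_def using norm_triangle_ineq[of "y0 - hinner y c" "hinner y c"] by simp
      also have "\<dots> \<le> norm x + norm c * norm y"
        using norm_hinner_le[of y c] by (simp add: mult.commute)
      finally have "(norm y0)\<^sup>2 \<le> (norm x + norm c * norm y)\<^sup>2"
        by (intro power_mono) auto
      then have "(1 - (norm c)\<^sup>2) * ((norm y0)\<^sup>2 - (norm y)\<^sup>2) \<le>
          (1 - (norm c)\<^sup>2) * ((norm x + norm c * norm y)\<^sup>2 - (norm y)\<^sup>2)"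
        using c1 by (intro mult_left_mono) auto
      also have "\<dots> = (norm x)\<^sup>2 - (norm c * norm x - (1 - (norm c)\<^sup>2) * norm y)\<^sup>2"
        by (simp add: algebra_simps power2_eq_square)
      also have "\<dots> \<le> (norm x)\<^sup>2" by simp
      finally have "m * ((norm y0)\<^sup>2 - (norm y)\<^sup>2) \<le> (1 - (norm d)\<^sup>2) * (norm x)\<^sup>2"
        unfolding m_def using d1 by (simp add: mult.assoc mult_left_mono)
      also have "(1 - (norm d)\<^sup>2) * (norm x)\<^sup>2 = (norm x)\<^sup>2 - (norm (x *s d))\<^sup>2"
        by (simp add: norm_scale_vec power_mult_distrib algebra_simps)
      also have "x *s d = y0 *s d + A *v y"
        by (simp add: A x_def vec_eq_iff algebra_simps)
      also have "x = y0 - hinner y c" by (rule x_def)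
      finally show "m * ((norm y0)\<^sup>2 - (norm y)\<^sup>2) \<le> (norm (y0 - hinner y c))\<^sup>2 - (norm (y0 *s d + A *v y))\<^sup>2" .
    qed
  qed
qed

section \<open>Positive semidefinite kernels\<close>

text \<open>With the conjugate on the second index, the form of a reproducing kernel is the squared
  norm of the combination of kernel functions with coefficients \<open>a\<close>.\<close>

definition kernel_form :: "'a set \<Rightarrow> ('a \<Rightarrow> 'a \<Rightarrow> complex) \<Rightarrow> ('a \<Rightarrow> complex) \<Rightarrow> complex" where
  "kernel_form F L a = (\<Sum>z\<in>F. \<Sum>w\<in>F. a z * cnj (a w) * L z w)"

text \<open>In the order on \<open>complex\<close>, \<open>0 \<le> x\<close> also says that
  \<open>x\<close> is real; hermitian symmetry of \<open>L\<close> is therefore a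
  consequence.\<close>

definition psd_on :: "'a set \<Rightarrow> ('a \<Rightarrow> 'a \<Rightarrow> complex) \<Rightarrow> bool" where
  "psd_on X L \<longleftrightarrow> (\<forall>F a. finite F \<longrightarrow> F \<subseteq> X \<longrightarrow> 0 \<le> kernel_form F L a)"

lemma psd_onI:
  "(\<And>F a. finite F \<Longrightarrow> F \<subseteq> X \<Longrightarrow> 0 \<le> kernel_form F L a) \<Longrightarrow> psd_on X L"
  by (simp add: psd_on_def)

lemma psd_onD: "psd_on X L \<Longrightarrow> finite F \<Longrightarrow> F \<subseteq> X \<Longrightarrow> 0 \<le> kernel_form F L a"
  by (simp add: psd_on_def)

lemma psd_on_subset: "psd_on X L \<Longrightarrow> Y \<subseteq> X \<Longrightarrow> psd_on Y L"
  by (auto simp: psd_on_def)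

lemma kernel_form_cong:
  "(\<And>z w. z \<in> F \<Longrightarrow> w \<in> F \<Longrightarrow> L z w = M z w) \<Longrightarrow> kernel_form F L a = kernel_form F M a"
  by (simp add: kernel_form_def cong: sum.cong)

lemma psd_on_cong:
  assumes "psd_on X L" "\<And>z w. z \<in> X \<Longrightarrow> w \<in> X \<Longrightarrow> L z w = M z w"
  shows "psd_on X M"
proof (rule psd_onI)
  fix F a assume F: "finite F" "F \<subseteq> X"
  have "kernel_form F M a = kernel_form F L a"
    by (rule kernel_form_cong) (use F in \<open>auto intro!: assms(2)[symmetric]\<close>)
  then show "0 \<le> kernel_form F M a" using psd_onD[OF assms(1) F] by simp
qed

lemma kernel_form_insert:
  assumes "finite F" "p \<notin> F"
  shows "kernel_form (insert p F) L a = a p * cnj (a p) * L p p + a p * (\<Sum>w\<in>F. cnj (a w) * L p w)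
     + cnj (a p) * (\<Sum>z\<in>F. a z * L z p) + kernel_form F L a"
  using assms by (simp add: kernel_form_def sum.distrib sum_distrib_left algebra_simps)

lemma psd_on_diag:
  assumes "psd_on X L" "z \<in> X"
  shows "0 \<le> L z z"
  using psd_onD[OF assms(1), of "{z}" "\<lambda>_. 1"] assms(2) by (simp add: kernel_form_def)

lemma kernel_form_pair:
  assumes "z \<noteq> w"
  shows "kernel_form {z, w} L a = a z * cnj (a z) * L z z + a z * cnj (a w) * L z w
     + a w * cnj (a z) * L w z + a w * cnj (a w) * L w w"
  using assms by (simp add: kernel_form_def algebra_simps)

text \<open>The form is real at the coefficients \<open>(1, 1)\<close> and \<open>(1, \<i>)\<close>:
  the first relates the imaginary parts of the two off-diagonal entries, the second their real
  parts.\<close>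

lemma psd_on_hermitian:
  assumes "psd_on X L" "z \<in> X" "w \<in> X"
  shows "L w z = cnj (L z w)"
proof (cases "z = w")
  case True
  then show ?thesis
    using psd_on_diag[OF assms(1,2)] by (simp add: complex_eq_iff less_eq_complex_def)
next
  case False
  have d: "Im (L z z) = 0" "Im (L w w) = 0"
    using psd_on_diag[OF assms(1)] assms by (auto simp: less_eq_complex_def)
  have "0 \<le> kernel_form {z, w} L a" for a
    using psd_onD[OF assms(1)] assms by auto
  from this[of "\<lambda>_. 1"] this[of "\<lambda>x. if x = z then 1 else \<i>"]
  show ?thesis
    using False d by (simp add: kernel_form_pair less_eq_complex_def complex_eq_iff)
qed

text \<open>Nonnegativity of a 2 by 2 minor, read off at coefficients that complete the square.
  Diagonal entries may vanish, whence the three overlapping cases.\<close>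

lemma psd_on_norm_le:
  assumes "psd_on X L" "z \<in> X" "w \<in> X"
  shows "(norm (L z w))\<^sup>2 \<le> Re (L z z) * Re (L w w)"
proof (cases "z = w")
  case True
  then show ?thesis
    using psd_on_diag[OF assms(1,2)]
    by (simp add: less_eq_complex_def cmod_power2) (simp add: power2_eq_square)
next
  case False
  define p s b where "p = Re (L z z)" and "s = Re (L w w)" and "b = L z w"
  have p: "L z z = of_real p" "p \<ge> 0" and s: "L w w = of_real s" "s \<ge> 0"
    using psd_on_diag[OF assms(1)] assms
    by (auto simp: less_eq_complex_def complex_eq_iff p_def s_def)
  have "0 \<le> Re (kernel_form {z, w} L a)" for a
    using psd_onD[OF assms(1), of "{z, w}" a] assms by (auto simp: less_eq_complex_def)
  note form_nonneg = this
  have form: "0 \<le> (norm x)\<^sup>2 * p + 2 * Re (x * cnj y * b) + (norm y)\<^sup>2 * s" for x y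
  proof -
    define a where "a = (\<lambda>u. if u = z then x else y)"
    have a: "a z = x" "a w = y" using False by (auto simp: a_def)
    have "kernel_form {z, w} L a = of_real ((norm x)\<^sup>2) * of_real p + x * cnj y * b +
       cnj (x * cnj y * b) + of_real ((norm y)\<^sup>2) * of_real s"
      unfolding kernel_form_pair[OF False] a p s psd_on_hermitian[OF assms] complex_norm_square b_def
      by (simp add: mult_ac)
    with form_nonneg[of a]
    have "0 \<le> Re (of_real ((norm x)\<^sup>2) * of_real p + x * cnj y * b + cnj (x * cnj y * b) +
       of_real ((norm y)\<^sup>2) * of_real s)" by simp
    then show ?thesis by (simp add: algebra_simps)
  qed
  have 1: "(norm b)\<^sup>2 \<le> p * s" if "p > 0"
  proof -
    have "0 \<le> p * (p * s - (norm b)\<^sup>2)"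
      using form[of "- cnj b" "of_real p"] by (simp add: cmod_power2) (simp add: power2_eq_square algebra_simps)
    then show ?thesis using that by (simp add: zero_le_mult_iff)
  qed
  have 2: "(norm b)\<^sup>2 \<le> p * s" if "s > 0"
  proof -
    have "0 \<le> s * (p * s - (norm b)\<^sup>2)"
      using form[of "of_real s" "- b"] by (simp add: cmod_power2) (simp add: power2_eq_square algebra_simps)
    then show ?thesis using that by (simp add: zero_le_mult_iff)
  qed
  have 3: "(norm b)\<^sup>2 \<le> p * s" if "p = 0" "s = 0"
    using form[of "- cnj b" 1] that by (simp add: cmod_power2) (simp add: power2_eq_square algebra_simps)
  have "(norm b)\<^sup>2 \<le> p * s"
    using 1 2 3 p(2) s(2) by (cases "p = 0"; cases "s = 0") (simp_all add: order_less_le)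
  then show ?thesis unfolding b_def p_def s_def .
qed

lemma psd_on_add:
  assumes "psd_on X L" "psd_on X M"
  shows "psd_on X (\<lambda>z w. L z w + M z w)"
proof (rule psd_onI)
  fix F a assume F: "finite F" "F \<subseteq> X"
  have "kernel_form F (\<lambda>z w. L z w + M z w) a = kernel_form F L a + kernel_form F M a"
    by (simp add: kernel_form_def algebra_simps sum.distrib)
  then show "0 \<le> kernel_form F (\<lambda>z w. L z w + M z w) a"
    using psd_onD[OF assms(1) F] psd_onD[OF assms(2) F] by simp
qed

lemma psd_on_scale:
  assumes "psd_on X L" "0 \<le> c"
  shows "psd_on X (\<lambda>z w. c * L z w)"
proof (rule psd_onI)
  fix F a assume F: "finite F" "F \<subseteq> X"
  have "kernel_form F (\<lambda>z w. c * L z w) a = c * kernel_form F L a"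
    by (simp add: kernel_form_def sum_distrib_left mult_ac)
  then show "0 \<le> kernel_form F (\<lambda>z w. c * L z w) a"
    using psd_onD[OF assms(1) F] assms(2) by simp
qed

lemma kernel_form_rank_one_mult:
  "kernel_form F (\<lambda>z w. u z * cnj (u w) * L z w) a = kernel_form F L (\<lambda>z. a z * u z)"
  by (simp add: kernel_form_def mult_ac)

lemma psd_on_rank_one_mult:
  "psd_on X L \<Longrightarrow> psd_on X (\<lambda>z w. u z * cnj (u w) * L z w)"
  by (simp add: psd_on_def kernel_form_rank_one_mult)

lemma psd_on_const:
  assumes "0 \<le> c"
  shows "psd_on X (\<lambda>_ _. c)"
proof (rule psd_onI)
  fix F :: "'a set" and a :: "'a \<Rightarrow> complex"
  have "(\<Sum>z\<in>F. a z) * cnj (\<Sum>z\<in>F. a z) = (\<Sum>z\<in>F. \<Sum>w\<in>F. a z * cnj (a w))"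
    by (simp add: sum_product)
  then have "kernel_form F (\<lambda>_ _. c) a = c * ((\<Sum>z\<in>F. a z) * cnj (\<Sum>z\<in>F. a z))"
    by (simp add: kernel_form_def sum_distrib_left mult_ac)
  also have "\<dots> = c * of_real ((norm (\<Sum>z\<in>F. a z))\<^sup>2)"
    by (simp only: complex_norm_square)
  finally show "0 \<le> kernel_form F (\<lambda>_ _. c) a"
    using assms by (simp add: less_eq_complex_def)
qed

lemma psd_on_sum:
  assumes "\<And>i. i \<in> I \<Longrightarrow> psd_on X (L i)"
  shows "psd_on X (\<lambda>z w. \<Sum>i\<in>I. L i z w)"
  using assms
proof (induction I rule: infinite_finite_induct)
  case (insert i I)
  then show ?case by (simp add: psd_on_add)
qed (simp_all add: psd_on_const)

lemma psd_on_limit: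
  assumes "\<And>n :: nat. psd_on X (L n)"
    and lim: "\<And>z w. z \<in> X \<Longrightarrow> w \<in> X \<Longrightarrow> (\<lambda>n. L n z w) \<longlonglongrightarrow> M z w"
  shows "psd_on X M"
proof (rule psd_onI)
  fix F a assume F: "finite F" "F \<subseteq> X"
  have lim: "(\<lambda>n. kernel_form F (L n) a) \<longlonglongrightarrow> kernel_form F M a"
    unfolding kernel_form_def by (intro tendsto_intros lim) (use F in auto)
  have nn: "0 \<le> kernel_form F (L n) a" for n
    using psd_onD[OF assms(1) F] .
  have "0 \<le> Re (kernel_form F M a)"
    by (rule LIMSEQ_le_const[OF tendsto_Re[OF lim]]) (use nn in \<open>auto simp: less_eq_complex_def\<close>)
  moreover have "Im (kernel_form F (L n) a) = 0" for n
    using nn[of n] by (simp add: less_eq_complex_def)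
  then have "Im (kernel_form F M a) = 0"
    using tendsto_Im[OF lim] LIMSEQ_unique[OF _ tendsto_const] by auto
  ultimately show "0 \<le> kernel_form F M a" by (simp add: less_eq_complex_def)
qed

section \<open>Schur product theorem\<close>

text \<open>Subtracting the rank-one kernel of the row of \<open>p\<close> is one step of a Cholesky decomposition.\<close>

lemma psd_on_cholesky_step:
  assumes L: "psd_on (insert p F) L" and p: "p \<notin> F"
  shows "psd_on F (\<lambda>z w. L z w - L z p * L p w / L p p)"
proof (cases "L p p = 0")
  \<comment> \<open>Division by zero yields 0, so nothing is subtracted from \<open>L\<close>
    here.\<close>
  case True
  then show ?thesis using psd_on_subset[OF L] by auto
next
  case False
  show ?thesis
  proof (rule psd_onI)
    fix G a assume G: "finite G" "G \<subseteq> F"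
    define \<sigma> where "\<sigma> = (\<Sum>z\<in>G. a z * L z p)"
    \<comment> \<open>The coefficient at \<open>p\<close> that minimises the form on
      \<open>insert p G\<close>; the minimum is the form of the reduced kernel.\<close>
    define b where "b = a(p := - \<sigma> / L p p)"
    have pG: "p \<notin> G" using G p by auto
    have Lp: "cnj (L p p) = L p p" "\<And>w. w \<in> G \<Longrightarrow> cnj (L w p) = L p w"
      using psd_on_hermitian[OF L] G by (metis insertI1 insertI2 subsetD)+
    have cs: "cnj \<sigma> = (\<Sum>w\<in>G. cnj (a w) * L p w)"
      unfolding \<sigma>_def by (simp add: Lp cong: sum.cong)
    have "kernel_form G (\<lambda>z w. L z w - L z p * L p w / L p p) a
        = kernel_form G L a - (\<Sum>z\<in>G. \<Sum>w\<in>G. (a z * L z p) * (cnj (a w) * L p w)) / L p p"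
      by (simp add: kernel_form_def right_diff_distrib sum_subtractf sum_divide_distrib mult_ac)
    also have "\<dots> = kernel_form G L a - \<sigma> * cnj \<sigma> / L p p"
      by (simp add: cs) (simp add: \<sigma>_def sum_product)
    also have "\<dots> = b p * cnj (b p) * L p p + b p * cnj \<sigma> + cnj (b p) * \<sigma> + kernel_form G L a"
      using False by (simp add: b_def Lp)
    also have "\<dots> = kernel_form (insert p G) L b"
    proof -
      have "(\<Sum>w\<in>G. cnj (b w) * L p w) = cnj \<sigma>" "(\<Sum>z\<in>G. b z * L z p) = \<sigma>"
        unfolding cs unfolding \<sigma>_def by (intro sum.cong; use pG in \<open>auto simp: b_def\<close>)+
      moreover have "kernel_form G L b = kernel_form G L a"
        unfolding kernel_form_def by (intro sum.cong) (use pG in \<open>auto simp: b_def\<close>)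
      ultimately show ?thesis using kernel_form_insert[OF G(1) pG, of L b] by simp
    qed
    also have "0 \<le> \<dots>" by (rule psd_onD[OF L]) (use G in auto)
    finally show "0 \<le> kernel_form G (\<lambda>z w. L z w - L z p * L p w / L p p) a" .
  qed
qed

text \<open>Induction on the points, splitting off from \<open>L\<close> the rank-one kernel of the
  row of \<open>p\<close>. Multiplying \<open>M\<close> by a rank-one kernel only rescales the
  coefficients, and the remainder of \<open>L\<close> vanishes in the row and column of
  \<open>p\<close>, so the induction hypothesis, for this new \<open>L\<close>, covers it.\<close>

lemma Schur_product_finite:
  assumes "finite F" "psd_on F L" "psd_on F M"
  shows "0 \<le> kernel_form F (\<lambda>z w. L z w * M z w) a"
  using assms
proof (induction F arbitrary: L rule: finite_induct)
  case empty
  then show ?case by (simp add: kernel_form_def)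
next
  case (insert p F)
  define L' where "L' = (\<lambda>z w. L z w - L z p * L p w / L p p)"
  have herm: "L p w = cnj (L w p)" if "w \<in> insert p F" for w
    using psd_on_hermitian[OF insert.prems(1)] that by blast
  \<comment> \<open>If \<open>L p p = 0\<close> nothing was subtracted, but then the minor bound
    makes the row itself zero.\<close>
  have row: "L' p w = 0 \<and> L' w p = 0" if "w \<in> insert p F" for w
  proof (cases "L p p = 0")
    case True
    then have "(norm (L p w))\<^sup>2 \<le> 0"
      using psd_on_norm_le[OF insert.prems(1), of p w] that by simp
    then show ?thesis using herm[OF that] True by (simp add: L'_def)
  qed (simp add: L'_def)
  have "kernel_form (insert p F) (\<lambda>z w. L z w * M z w) a =
      kernel_form (insert p F) (\<lambda>z w. (1 / L p p) * (L z p * cnj (L w p) * M z w)) a +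
      kernel_form (insert p F) (\<lambda>z w. L' z w * M z w) a"
    unfolding kernel_form_def sum.distrib[symmetric]
  proof (intro sum.cong refl)
    fix z w assume "w \<in> insert p F"
    then show "a z * cnj (a w) * (L z w * M z w) = a z * cnj (a w) * (1 / L p p * (L z p * cnj (L w p) * M z w))
        + a z * cnj (a w) * (L' z w * M z w)"
      unfolding L'_def herm[OF \<open>w \<in> insert p F\<close>, symmetric] by (simp add: algebra_simps)
  qed
  also have "kernel_form (insert p F) (\<lambda>z w. L' z w * M z w) a = kernel_form F (\<lambda>z w. L' z w * M z w) a"
    using insert.hyps by (simp add: kernel_form_insert row)
  finally have eq: "kernel_form (insert p F) (\<lambda>z w. L z w * M z w) a =
      kernel_form (insert p F) (\<lambda>z w. (1 / L p p) * (L z p * cnj (L w p) * M z w)) a +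
      kernel_form F (\<lambda>z w. L' z w * M z w) a" .
  have "0 \<le> L p p" using psd_on_diag[OF insert.prems(1)] by simp
  then have "0 \<le> 1 / L p p"
    by (auto simp: less_eq_complex_def Re_divide Im_divide)
  from psd_onD[OF psd_on_scale[OF psd_on_rank_one_mult[OF insert.prems(2)] this], of "insert p F"]
  have "0 \<le> kernel_form (insert p F) (\<lambda>z w. (1 / L p p) * (L z p * cnj (L w p) * M z w)) a"
    using insert.hyps by simp
  moreover have "0 \<le> kernel_form F (\<lambda>z w. L' z w * M z w) a"
  proof (rule insert.IH)
    show "psd_on F L'" unfolding L'_def by (rule psd_on_cholesky_step[OF insert.prems(1) insert.hyps(2)])
    show "psd_on F M" using psd_on_subset[OF insert.prems(2)] by auto
  qed
  ultimately show ?case unfolding eq by simp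
qed

lemma psd_on_mult:
  assumes "psd_on X L" "psd_on X M"
  shows "psd_on X (\<lambda>z w. L z w * M z w)"
  by (rule psd_onI) (intro Schur_product_finite psd_on_subset[OF assms(1)] psd_on_subset[OF assms(2)])

section \<open>Powers and the binomial series\<close>

lemma psd_on_power:
  assumes "psd_on X L"
  shows "psd_on X (\<lambda>z w. L z w ^ n)"
  by (induction n) (simp_all add: psd_on_const psd_on_mult assms less_eq_complex_def)

text \<open>The binomial series has nonnegative coefficients, and powers of \<open>L\<close> are
  positive semidefinite by the Schur product. Its constant term is 1, so subtracting 1 still leaves
  a limit of positive semidefinite partial sums.\<close>

lemma psd_on_one_minus_powr_diff:
  assumes L: "psd_on X L" and lt: "\<And>z w. z \<in> X \<Longrightarrow> w \<in> X \<Longrightarrow> norm (L z w) < 1"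
    and g: "\<gamma> > 0"
  shows "psd_on X (\<lambda>z w. (1 - L z w) powr (- of_real \<gamma>) - 1)"
proof -
  \<comment> \<open>The generalised binomial coefficient of -\<gamma> with its sign absorbed by the
    power of \<open>- L z w\<close>.\<close>
  define b where "b n = (pochhammer (of_real \<gamma>) n / fact n :: complex)" for n
  have b: "0 \<le> b n" for n
  proof -
    have "b n = of_real (pochhammer \<gamma> n / fact n)"
      by (simp add: b_def pochhammer_of_real)
    moreover have "pochhammer \<gamma> n / fact n \<ge> 0"
      using g by (simp add: pochhammer_pos less_imp_le)
    ultimately show ?thesis
      by (simp only: less_eq_complex_def Re_complex_of_real Im_complex_of_real zero_complex.sel)
  qed
  have sums: "(\<lambda>n. b n * L z w ^ n) sums (1 - L z w) powr (- of_real \<gamma>)"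
    if "z \<in> X" "w \<in> X" for z w
  proof -
    have "((- of_real \<gamma>) gchoose n) * (- L z w) ^ n = b n * L z w ^ n" for n
    proof -
      have "(- 1) ^ n * (- 1) ^ n = (1 :: complex)"
        by (simp flip: power_mult_distrib)
      then show ?thesis
        by (simp add: gbinomial_pochhammer b_def power_minus[of "L z w"] mult_ac)
    qed
    then show ?thesis
      using gen_binomial_complex[of "- L z w" "- of_real \<gamma>"] lt[OF that] by simp
  qed
  show ?thesis
  proof (rule psd_on_limit)
    show "psd_on X (\<lambda>z w. \<Sum>k<n. b (Suc k) * L z w ^ Suc k)" for n
      by (intro psd_on_sum psd_on_scale psd_on_power L b)
    fix z w assume "z \<in> X" "w \<in> X"
    from sums[OF this]
    have "(\<lambda>k. b (Suc k) * L z w ^ Suc k) sums ((1 - L z w) powr (- of_real \<gamma>) - b 0 * L z w ^ 0)"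
      by (subst sums_Suc_iff) simp
    then show "(\<lambda>n. \<Sum>k<n. b (Suc k) * L z w ^ Suc k) \<longlonglongrightarrow> (1 - L z w) powr (- of_real \<gamma>) - 1"
      by (simp add: sums_def b_def)
  qed
qed

lemma psd_on_one_minus_powr:
  assumes "psd_on X L" "\<And>z w. z \<in> X \<Longrightarrow> w \<in> X \<Longrightarrow> norm (L z w) < 1" "\<gamma> > 0"
  shows "psd_on X (\<lambda>z w. (1 - L z w) powr (- of_real \<gamma>))"
  using psd_on_add[OF psd_on_one_minus_powr_diff[OF assms] psd_on_const[of 1]]
  by (simp add: less_eq_complex_def)

text \<open>A Gram kernel; the arguments are exchanged because
  \<open>ball_kernel \<gamma> z w\<close> depends on \<open>hinner w z\<close>.\<close>

lemma psd_on_hinner: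
  "psd_on X (\<lambda>z w. hinner (u w) (u z))"
proof (rule psd_onI)
  fix F :: "'a set" and a :: "'a \<Rightarrow> complex"
  define y where "y = (\<Sum>w\<in>F. cnj (a w) *s u w)"
  have "kernel_form F (\<lambda>z w. hinner (u w) (u z)) a = hinner y y"
    unfolding y_def hinner_sum_right unfolding hinner_sum_left
    by (simp add: kernel_form_def hinner_scale_left hinner_scale_right mult_ac)
  then show "0 \<le> kernel_form F (\<lambda>z w. hinner (u w) (u z)) a"
    by (simp add: hinner_self less_eq_complex_def)
qed

section \<open>Operators on reproducing kernel Hilbert spaces\<close>

context hilbert_function_space
begin

definition hnorm :: "('a \<Rightarrow> complex) \<Rightarrow> real" where
  "hnorm h = sqrt (Re (ip h h))"

lemma hnorm_nonneg: "h \<in> H \<Longrightarrow> 0 \<le> hnorm h"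
  by (simp add: hnorm_def ip_nonneg)

lemma hnorm_sq: "h \<in> H \<Longrightarrow> (hnorm h)\<^sup>2 = Re (ip h h)"
  by (simp add: hnorm_def ip_nonneg)

lemma ip_self: "h \<in> H \<Longrightarrow> ip h h = of_real ((hnorm h)\<^sup>2)"
  using ip_cnj[of h h] by (simp add: hnorm_sq complex_eq_iff)

lemma diff_closed: "h \<in> H \<Longrightarrow> k \<in> H \<Longrightarrow> (\<lambda>x. h x - k x) \<in> H"
  using add_closed[of h "\<lambda>x. - 1 * k x"] scale_closed[of k "- 1"] by simp

lemma ip_diff: "h \<in> H \<Longrightarrow> k \<in> H \<Longrightarrow> l \<in> H \<Longrightarrow> ip (\<lambda>x. h x - k x) l = ip h l - ip k l"
  using ip_add[of h "\<lambda>x. - 1 * k x" l] scale_closed[of k "- 1"] ip_scale[of k l "- 1"] by simp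

lemma ip_add_right: "h \<in> H \<Longrightarrow> k \<in> H \<Longrightarrow> l \<in> H \<Longrightarrow> ip l (\<lambda>x. h x + k x) = ip l h + ip l k"
  by (metis (no_types, lifting) add_closed complex_cnj_add ip_add ip_cnj)

lemma ip_diff_right: "h \<in> H \<Longrightarrow> k \<in> H \<Longrightarrow> l \<in> H \<Longrightarrow> ip l (\<lambda>x. h x - k x) = ip l h - ip l k"
  by (metis (no_types, lifting) diff_closed complex_cnj_diff ip_diff ip_cnj)

lemma ip_scale_right: "h \<in> H \<Longrightarrow> l \<in> H \<Longrightarrow> ip l (\<lambda>x. c * h x) = cnj c * ip l h"
  by (metis (no_types, lifting) scale_closed complex_cnj_mult ip_scale ip_cnj)

lemma ip_zero_left: "l \<in> H \<Longrightarrow> ip (\<lambda>_. 0) l = 0"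
  using ip_scale[of "\<lambda>_. 0" l 0] zero_closed by simp

lemma sum_closed:
  "(\<And>i. i \<in> I \<Longrightarrow> v i \<in> H) \<Longrightarrow> (\<lambda>x. \<Sum>i\<in>I. v i x) \<in> H"
  by (induction I rule: infinite_finite_induct) (simp_all add: zero_closed add_closed)

lemma ip_sum:
  "(\<And>i. i \<in> I \<Longrightarrow> v i \<in> H) \<Longrightarrow> l \<in> H \<Longrightarrow> ip (\<lambda>x. \<Sum>i\<in>I. v i x) l = (\<Sum>i\<in>I. ip (v i) l)"
  by (induction I rule: infinite_finite_induct) (simp_all add: ip_zero_left ip_add sum_closed)

lemma ip_sum_right:
  assumes "\<And>i. i \<in> I \<Longrightarrow> v i \<in> H" "l \<in> H"
  shows "ip l (\<lambda>x. \<Sum>i\<in>I. v i x) = (\<Sum>i\<in>I. ip l (v i))"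
proof -
  have "ip l (\<lambda>x. \<Sum>i\<in>I. v i x) = cnj (ip (\<lambda>x. \<Sum>i\<in>I. v i x) l)"
    by (rule ip_cnj) (use assms in \<open>auto intro: sum_closed\<close>)
  also have "\<dots> = (\<Sum>i\<in>I. ip l (v i))"
    using assms by (simp add: ip_sum ip_cnj[of _ l] cong: sum.cong)
  finally show ?thesis .
qed

lemma ip_linear_combination:
  assumes "\<And>i. i \<in> I \<Longrightarrow> v i \<in> H"
  shows "ip (\<lambda>x. \<Sum>i\<in>I. a i * v i x) (\<lambda>x. \<Sum>i\<in>I. a i * v i x)
    = kernel_form I (\<lambda>i j. ip (v i) (v j)) a"
proof -
  have "ip (\<lambda>x. \<Sum>i\<in>I. a i * v i x) (\<lambda>x. \<Sum>i\<in>I. a i * v i x) =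
      (\<Sum>i\<in>I. \<Sum>j\<in>I. ip (\<lambda>x. a i * v i x) (\<lambda>x. a j * v j x))"
    using assms by (simp add: ip_sum ip_sum_right scale_closed sum_closed cong: sum.cong)
  also have "\<dots> = kernel_form I (\<lambda>i j. ip (v i) (v j)) a"
    unfolding kernel_form_def using assms
    by (intro sum.cong) (simp_all add: ip_scale ip_scale_right scale_closed mult_ac)
  finally show ?thesis .
qed

text \<open>Taking the vectors themselves as indices makes Cauchy-Schwarz an instance of
  \<open>psd_on_norm_le\<close>.\<close>

lemma psd_on_ip: "psd_on H ip"
proof (rule psd_onI)
  fix F :: "('a \<Rightarrow> complex) set" and a assume F: "finite F" "F \<subseteq> H"
  let ?s = "\<lambda>x. \<Sum>h\<in>F. a h * h x"
  have s: "?s \<in> H" using F by (auto intro!: sum_closed scale_closed)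
  have "kernel_form F ip a = ip ?s ?s"
    by (rule ip_linear_combination[symmetric]) (use F in auto)
  then show "0 \<le> kernel_form F ip a" by (simp add: ip_self[OF s] less_eq_complex_def)
qed

lemma Cauchy_Schwarz:
  assumes "h \<in> H" "k \<in> H"
  shows "norm (ip h k) \<le> hnorm h * hnorm k"
  by (rule power2_le_imp_le)
     (use psd_on_norm_le[OF psd_on_ip assms] assms in
       \<open>simp_all add: hnorm_sq power_mult_distrib hnorm_nonneg\<close>)

lemma hnorm_triangle:
  assumes "h \<in> H" "k \<in> H"
  shows "hnorm (\<lambda>x. h x + k x) \<le> hnorm h + hnorm k"
proof (rule power2_le_imp_le)
  have "Re (ip h k) \<le> hnorm h * hnorm k" "Re (ip k h) \<le> hnorm h * hnorm k"
    using Cauchy_Schwarz[OF assms] complex_Re_le_cmod[of "ip h k"] ip_cnj[OF assms] by auto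
  then show "(hnorm (\<lambda>x. h x + k x))\<^sup>2 \<le> (hnorm h + hnorm k)\<^sup>2"
    using assms by (simp add: hnorm_sq add_closed ip_add ip_add_right power2_sum)
qed (simp add: assms hnorm_nonneg)

lemma hnorm_minus_commute:
  assumes "h \<in> H" "k \<in> H"
  shows "hnorm (\<lambda>x. h x - k x) = hnorm (\<lambda>x. k x - h x)"
  using assms by (simp add: hnorm_def ip_diff ip_diff_right diff_closed algebra_simps)

lemma hnorm_diff_triangle:
  assumes "h \<in> H" "k \<in> H" "l \<in> H"
  shows "hnorm (\<lambda>x. h x - l x) \<le> hnorm (\<lambda>x. h x - k x) + hnorm (\<lambda>x. k x - l x)"
  using hnorm_triangle[of "\<lambda>x. h x - k x" "\<lambda>x. k x - l x"] assms by (simp add: diff_closed)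

lemma hnorm_le_diff:
  assumes "h \<in> H" "k \<in> H"
  shows "hnorm h \<le> hnorm (\<lambda>x. h x - k x) + hnorm k"
  using hnorm_triangle[of "\<lambda>x. h x - k x" k] assms by (simp add: diff_closed)

lemma parallelogram:
  assumes "h \<in> H" "k \<in> H"
  shows "(hnorm (\<lambda>x. h x - k x))\<^sup>2 = 2 * (hnorm h)\<^sup>2 + 2 * (hnorm k)\<^sup>2 - (hnorm (\<lambda>x. h x + k x))\<^sup>2"
  using assms
  by (simp add: hnorm_sq diff_closed add_closed ip_add ip_add_right ip_diff ip_diff_right)

lemma hnorm_scale: "h \<in> H \<Longrightarrow> hnorm (\<lambda>x. c * h x) = norm c * hnorm h"
proof -
  assume h: "h \<in> H"
  have "ip (\<lambda>x. c * h x) (\<lambda>x. c * h x) = (c * cnj c) * ip h h"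
    using h by (simp add: ip_scale ip_scale_right scale_closed)
  also have "\<dots> = of_real ((norm c)\<^sup>2 * (hnorm h)\<^sup>2)"
    by (simp add: ip_self[OF h] flip: complex_norm_square)
  finally have "Re (ip (\<lambda>x. c * h x) (\<lambda>x. c * h x)) = (norm c * hnorm h)\<^sup>2"
    by (simp only: Re_complex_of_real power_mult_distrib)
  then show ?thesis
    unfolding hnorm_def[of "\<lambda>x. c * h x"] using hnorm_nonneg[OF h] by simp
qed

lemma Cauchy_imp_convergent:
  assumes "\<And>i. s i \<in> H"
    and "\<And>e. e > 0 \<Longrightarrow> \<exists>N. \<forall>i\<ge>N. \<forall>j\<ge>N. hnorm (\<lambda>x. s i x - s j x) < e"
  obtains h where "h \<in> H" "(\<lambda>i. hnorm (\<lambda>x. s i x - h x)) \<longlonglongrightarrow> 0"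
proof -
  have "\<exists>h\<in>H. (\<lambda>i. hnorm (\<lambda>x. s i x - h x)) \<longlonglongrightarrow> 0"
    unfolding hnorm_def by (rule complete) (use assms in \<open>simp_all add: hnorm_def\<close>)
  then show thesis using that by blast
qed

text \<open>
  A sequence in \<open>D\<close> minimising the distance to \<open>h\<close> is Cauchy by the parallelogram law, and \<open>h\<close> minus
  its limit is orthogonal to \<open>D\<close>.
\<close>

lemma dense_if_orthogonal_trivial:
  assumes D: "D \<subseteq> H" "(\<lambda>_. 0) \<in> D"
    and add: "\<And>k l. k \<in> D \<Longrightarrow> l \<in> D \<Longrightarrow> (\<lambda>x. k x + l x) \<in> D"
    and scale: "\<And>c k. k \<in> D \<Longrightarrow> (\<lambda>x. c * k x) \<in> D"
    and orth: "\<And>u. u \<in> H \<Longrightarrow> (\<And>k. k \<in> D \<Longrightarrow> ip u k = 0) \<Longrightarrow> u = (\<lambda>_. 0)"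
    and h: "h \<in> H"
  obtains s where "\<And>n :: nat. s n \<in> D" "(\<lambda>n. hnorm (\<lambda>x. s n x - h x)) \<longlonglongrightarrow> 0"
proof -
  have DH: "k \<in> D \<Longrightarrow> k \<in> H" for k using D by auto
  define N where "N k = (hnorm (\<lambda>x. h x - k x))\<^sup>2" for k
  define \<delta> where "\<delta> = Inf (N ` D)"
  have bdd: "bdd_below (N ` D)" by (rule bdd_belowI[of _ 0]) (auto simp: N_def)
  have \<delta>_le: "\<delta> \<le> N k" if "k \<in> D" for k
    unfolding \<delta>_def using that bdd by (auto intro: cInf_lower)
  have "\<exists>k\<in>D. N k < \<delta> + 1 / real (Suc n)" for n
    using cInf_lessD[of "N ` D" "\<delta> + 1 / real (Suc n)"] D by (auto simp: \<delta>_def)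
  then obtain s where s: "\<And>n. s n \<in> D" "\<And>n. N (s n) < \<delta> + 1 / real (Suc n)"
    by metis
  have sH: "s n \<in> H" for n using s DH by blast
  have close: "(hnorm (\<lambda>x. s i x - s j x))\<^sup>2 \<le> 2 / real (Suc i) + 2 / real (Suc j)" for i j
  proof -
    \<comment> \<open>The midpoint lies in \<open>D\<close>, so its squared distance to
      \<open>h\<close> is at least \<delta>; the parallelogram law then bounds the distance from
      \<open>s i\<close> to \<open>s j\<close>.\<close>
    define m where "m = (\<lambda>x. (1 / 2) * (s i x + s j x))"
    have m: "m \<in> D" unfolding m_def using s add scale by blast
    have "(hnorm (\<lambda>x. s i x - s j x))\<^sup>2 = (hnorm (\<lambda>x. (h x - s j x) - (h x - s i x)))\<^sup>2"
      by simp
    also have "\<dots> = 2 * N (s j) + 2 * N (s i) - (hnorm (\<lambda>x. (h x - s j x) + (h x - s i x)))\<^sup>2"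
      unfolding N_def by (rule parallelogram) (use h sH diff_closed in auto)
    also have "(\<lambda>x. (h x - s j x) + (h x - s i x)) = (\<lambda>x. 2 * (h x - m x))"
      by (auto simp: m_def algebra_simps)
    also have "(hnorm (\<lambda>x. 2 * (h x - m x)))\<^sup>2 = 4 * N m"
      using hnorm_scale[OF diff_closed[OF h DH[OF m]], of 2] by (simp add: N_def power_mult_distrib)
    finally have "(hnorm (\<lambda>x. s i x - s j x))\<^sup>2 = 2 * N (s j) + 2 * N (s i) - 4 * N m" .
    moreover have "2 / real (Suc l) = 2 * (1 / real (Suc l))" for l by simp
    ultimately show ?thesis using s(2)[of i] s(2)[of j] \<delta>_le[OF m] by linarith
  qed
  obtain k where k: "k \<in> H" "(\<lambda>i. hnorm (\<lambda>x. s i x - k x)) \<longlonglongrightarrow> 0"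
  proof (rule Cauchy_imp_convergent[of s])
    fix e :: real assume e: "e > 0"
    obtain n where n: "4 / e\<^sup>2 < real n" using reals_Archimedean2 by blast
    show "\<exists>N. \<forall>i\<ge>N. \<forall>j\<ge>N. hnorm (\<lambda>x. s i x - s j x) < e"
    proof (intro exI allI impI)
      fix i j assume "n \<le> i" "n \<le> j"
      then have "2 / real (Suc i) \<le> 2 / real (Suc n)" "2 / real (Suc j) \<le> 2 / real (Suc n)"
        by (auto intro!: divide_left_mono)
      then have "(hnorm (\<lambda>x. s i x - s j x))\<^sup>2 \<le> 4 / real (Suc n)"
        using close[of i j] by simp
      also have "\<dots> < e\<^sup>2"
        using n e by (simp add: field_simps) (smt (verit) zero_less_power)
      finally show "hnorm (\<lambda>x. s i x - s j x) < e"
        by (rule power2_less_imp_less) (use e in auto)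
    qed
  qed (use sH in auto)
  define u where "u = (\<lambda>x. h x - k x)"
  have u: "u \<in> H" unfolding u_def using h k diff_closed by blast
  have "ip u l = 0" if l: "l \<in> D" for l
  proof (rule ccontr)
    assume nz: "ip u l \<noteq> 0"
    define b where "b = ip u l"
    \<comment> \<open>Moving \<open>s n\<close> by \<open>c * l\<close> cannot push the squared
      distance below \<delta>. For \<open>c\<close> a multiple of \<open>b\<close> this forces
      \<open>t\<close> times the squared norm of \<open>l\<close> to be at least 2, and
      \<open>t\<close> is chosen to keep that product below 1.\<close>
    define t where "t = 1 / (1 + (hnorm l)\<^sup>2)"
    define c where "c = of_real t * b"
    have t: "t > 0" "t * (hnorm l)\<^sup>2 < 1"
      by (auto simp: t_def add_pos_nonneg divide_simps)
    have lH: "l \<in> H" using l DH by blast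
    have bound: "2 * Re (cnj c * ip (\<lambda>x. h x - s n x) l) \<le> 1 / real (Suc n) + (norm c)\<^sup>2 * (hnorm l)\<^sup>2" for n
    proof -
      let ?v = "\<lambda>x. h x - s n x" and ?w = "\<lambda>x. c * l x"
      have v: "?v \<in> H" and w: "?w \<in> H" using h sH lH diff_closed scale_closed by auto
      have "(\<lambda>x. s n x + c * l x) \<in> D" using add scale s(1) l by blast
      from \<delta>_le[OF this] have "\<delta> \<le> (hnorm (\<lambda>x. ?v x - ?w x))\<^sup>2"
        by (simp add: N_def algebra_simps)
      also have "\<dots> = (hnorm ?v)\<^sup>2 + (hnorm ?w)\<^sup>2 - Re (ip ?v ?w) - Re (ip ?w ?v)"
        using v w by (simp add: hnorm_sq diff_closed[OF v w] ip_diff ip_diff_right diff_closed)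
      also have "Re (ip ?w ?v) = Re (ip ?v ?w)" using ip_cnj[OF v w] by simp
      also have "ip ?v ?w = cnj c * ip ?v l" by (rule ip_scale_right[OF lH v])
      also have "hnorm ?w = norm c * hnorm l" by (rule hnorm_scale[OF lH])
      finally show ?thesis using s(2)[of n] by (simp add: N_def power_mult_distrib)
    qed
    have lim: "(\<lambda>n. ip (\<lambda>x. h x - s n x) l) \<longlonglongrightarrow> b"
    proof (rule Lim_null_comparison[THEN LIM_zero_cancel])
      show "\<forall>\<^sub>F n in sequentially. norm (ip (\<lambda>x. h x - s n x) l - b) \<le> hnorm (\<lambda>x. s n x - k x) * hnorm l"
      proof (rule always_eventually, rule allI)
        fix n
        have "ip (\<lambda>x. h x - s n x) l - b = - ip (\<lambda>x. s n x - k x) l"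
          using h k(1) sH lH by (simp add: b_def u_def ip_diff diff_closed)
        then show "norm (ip (\<lambda>x. h x - s n x) l - b) \<le> hnorm (\<lambda>x. s n x - k x) * hnorm l"
          using Cauchy_Schwarz[OF diff_closed[OF sH k(1)] lH] by simp
      qed
      show "(\<lambda>n. hnorm (\<lambda>x. s n x - k x) * hnorm l) \<longlonglongrightarrow> 0"
        using tendsto_mult_left_zero[OF k(2)] by simp
    qed
    have le: "2 * Re (cnj c * b) \<le> 0 + (norm c)\<^sup>2 * (hnorm l)\<^sup>2"
    proof (rule LIMSEQ_le)
      show "(\<lambda>n. 2 * Re (cnj c * ip (\<lambda>x. h x - s n x) l)) \<longlonglongrightarrow> 2 * Re (cnj c * b)"
        by (intro tendsto_intros lim)
      show "(\<lambda>n. 1 / real (Suc n) + (norm c)\<^sup>2 * (hnorm l)\<^sup>2) \<longlonglongrightarrow> 0 + (norm c)\<^sup>2 * (hnorm l)\<^sup>2"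
        by (intro tendsto_add tendsto_const LIMSEQ_Suc[OF lim_1_over_n])
    qed (use bound in auto)
    have cb: "cnj c * b = of_real (t * (norm b)\<^sup>2)"
      unfolding of_real_mult complex_norm_square c_def by (simp add: mult_ac)
    have nc: "(norm c)\<^sup>2 = t * (t * (norm b)\<^sup>2)"
      using t by (simp add: c_def norm_mult power_mult_distrib power2_eq_square)
    have "2 * (t * (norm b)\<^sup>2) \<le> (t * (hnorm l)\<^sup>2) * (t * (norm b)\<^sup>2)"
      using le unfolding cb nc Re_complex_of_real by (simp add: mult_ac)
    moreover have "t * (norm b)\<^sup>2 > 0" using t nz by (simp add: b_def)
    ultimately have "2 \<le> t * (hnorm l)\<^sup>2" using mult_le_cancel_right_pos by blast
    then show False using t by simp
  qed
  then have "u = (\<lambda>_. 0)" using orth u by blast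
  then have "k = h" by (auto simp: u_def fun_eq_iff)
  with k(2) show thesis by (intro that[of s] s(1)) simp
qed

end

section \<open>The span of the kernel functions and operators determined on it\<close>

context reproducing_kernel_hilbert_space
begin

definition kernel_span :: "('a \<Rightarrow> complex) set" where
  "kernel_span = {\<lambda>x. \<Sum>z\<in>F. a z * K z x | F a. finite F \<and> F \<subseteq> X}"

lemma kernel_span_subset: "kernel_span \<subseteq> H"
  by (auto simp: kernel_span_def intro!: sum_closed scale_closed kernel_closed)

lemma kernel_in_span: "z \<in> X \<Longrightarrow> K z \<in> kernel_span"
  unfolding kernel_span_def by (rule CollectI, rule exI[of _ "{z}"], rule exI[of _ "\<lambda>_. 1"]) auto

lemma kernel_span_zero: "(\<lambda>_. 0) \<in> kernel_span"
  unfolding kernel_span_def by (rule CollectI, rule exI[of _ "{}"]) auto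

lemma kernel_span_scale: "k \<in> kernel_span \<Longrightarrow> (\<lambda>x. c * k x) \<in> kernel_span"
proof -
  assume "k \<in> kernel_span"
  then obtain F a where F: "finite F" "F \<subseteq> X" "k = (\<lambda>x. \<Sum>z\<in>F. a z * K z x)"
    unfolding kernel_span_def by blast
  show ?thesis
    unfolding kernel_span_def
    by (rule CollectI, rule exI[of _ F], rule exI[of _ "\<lambda>z. c * a z"])
       (use F in \<open>auto simp: sum_distrib_left mult_ac\<close>)
qed

lemma kernel_span_add:
  assumes "k \<in> kernel_span" "l \<in> kernel_span"
  shows "(\<lambda>x. k x + l x) \<in> kernel_span"
proof -
  from assms obtain F a G b where F: "finite F" "F \<subseteq> X" "k = (\<lambda>x. \<Sum>z\<in>F. a z * K z x)"
    and G: "finite G" "G \<subseteq> X" "l = (\<lambda>x. \<Sum>z\<in>G. b z * K z x)"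
    unfolding kernel_span_def by blast
  \<comment> \<open>Coefficients extended by zero let both sums run over the union.\<close>
  define a' b' where "a' z = (if z \<in> F then a z else 0)" and "b' z = (if z \<in> G then b z else 0)" for z
  have k: "k = (\<lambda>x. \<Sum>z\<in>F \<union> G. a' z * K z x)"
    unfolding F(3) by (intro ext sum.mono_neutral_cong_left) (use F G in \<open>auto simp: a'_def\<close>)
  have l: "l = (\<lambda>x. \<Sum>z\<in>F \<union> G. b' z * K z x)"
    unfolding G(3) by (intro ext sum.mono_neutral_cong_left) (use F G in \<open>auto simp: b'_def\<close>)
  show ?thesis
    unfolding kernel_span_def
    by (rule CollectI, rule exI[of _ "F \<union> G"], rule exI[of _ "\<lambda>z. a' z + b' z"])
       (use F(1,2) G(1,2) in \<open>simp add: k l sum.distrib algebra_simps\<close>)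
qed

text \<open>A vector orthogonal to all kernel functions vanishes on \<open>X\<close> by the
  reproducing property, and off \<open>X\<close> by the convention of extension by zero.\<close>

lemma kernel_span_dense:
  assumes "h \<in> H"
  obtains s where "\<And>n :: nat. s n \<in> kernel_span" "(\<lambda>n. hnorm (\<lambda>x. s n x - h x)) \<longlonglongrightarrow> 0"
proof (rule dense_if_orthogonal_trivial[OF kernel_span_subset kernel_span_zero kernel_span_add
      kernel_span_scale _ assms])
  fix u assume u: "u \<in> H" "\<And>k. k \<in> kernel_span \<Longrightarrow> ip u k = 0"
  have "u x = 0" for x
    using zero_outside[OF u(1), of x] reproducing[OF u(1), of x] u(2)[OF kernel_in_span[of x]]
    by (cases "x \<in> X") auto
  then show "u = (\<lambda>_. 0)" by auto
qed (use that in blast)+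

lemma norm_eval_le: "h \<in> H \<Longrightarrow> x \<in> X \<Longrightarrow> norm (h x) \<le> hnorm h * hnorm (K x)"
  using Cauchy_Schwarz[of h "K x"] reproducing[of h x] kernel_closed[of x] by simp

lemma ip_kernel_left: "h \<in> H \<Longrightarrow> x \<in> X \<Longrightarrow> ip (K x) h = cnj (h x)"
  using ip_cnj[of h "K x"] reproducing[of h x] kernel_closed[of x] by simp

text \<open>At first \<open>T h\<close> is just a function. For approximants \<open>s n\<close> from
  the span, \<open>T (s n)\<close> is Cauchy and converges in \<open>H\<close>; since point
  evaluations are bounded, it also converges pointwise, and its pointwise limit is
  \<open>T h\<close>.\<close>

lemma weighted_composition_extends_from_span:
  assumes T: "\<And>h x. T h x = (if x \<in> X then f x * h (\<phi> x) else 0)"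
    and \<phi>: "\<And>x. x \<in> X \<Longrightarrow> \<phi> x \<in> X"
    and M: "M \<ge> 0"
    and span: "\<And>k. k \<in> kernel_span \<Longrightarrow> T k \<in> H \<and> hnorm (T k) \<le> M * hnorm k"
    and h: "h \<in> H"
  shows "T h \<in> H \<and> hnorm (T h) \<le> M * hnorm h"
proof -
  obtain s where s: "\<And>n :: nat. s n \<in> kernel_span" "(\<lambda>n. hnorm (\<lambda>x. s n x - h x)) \<longlonglongrightarrow> 0"
    using kernel_span_dense[OF h] by blast
  have sH: "s n \<in> H" and TsH: "T (s n) \<in> H" for n using s kernel_span_subset span by auto
  have Tdiff: "hnorm (\<lambda>x. T (s i) x - T (s j) x) \<le> M * hnorm (\<lambda>x. s i x - s j x)" for i j
  proof -
    have "(\<lambda>x. s i x - s j x) = (\<lambda>x. s i x + (- 1) * s j x)" by simp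
    then have "(\<lambda>x. s i x - s j x) \<in> kernel_span"
      using kernel_span_add[OF s(1) kernel_span_scale[OF s(1), of "- 1"]] by simp
    from span[OF this] have "hnorm (T (\<lambda>x. s i x - s j x)) \<le> M * hnorm (\<lambda>x. s i x - s j x)" by simp
    also have "T (\<lambda>x. s i x - s j x) = (\<lambda>x. T (s i) x - T (s j) x)"
      by (auto simp: T algebra_simps)
    finally show ?thesis .
  qed
  obtain u where u: "u \<in> H" "(\<lambda>i. hnorm (\<lambda>x. T (s i) x - u x)) \<longlonglongrightarrow> 0"
  proof (rule Cauchy_imp_convergent[of "\<lambda>i. T (s i)"])
    fix e :: real assume e: "e > 0"
    \<comment> \<open>Using \<open>M + 1\<close> avoids a division by zero when
      \<open>M = 0\<close>; the 2 pays for the triangle inequality.\<close>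
    define e' where "e' = e / (2 * (M + 1))"
    have e': "e' > 0" using e M by (simp add: e'_def)
    obtain N where N: "\<And>n. n \<ge> N \<Longrightarrow> hnorm (\<lambda>x. s n x - h x) < e'"
      using LIMSEQ_D[OF s(2) e'] by (auto simp: hnorm_nonneg diff_closed[OF sH h])
    show "\<exists>N. \<forall>i\<ge>N. \<forall>j\<ge>N. hnorm (\<lambda>x. T (s i) x - T (s j) x) < e"
    proof (intro exI allI impI)
      fix i j assume ij: "N \<le> i" "N \<le> j"
      have "hnorm (\<lambda>x. s i x - s j x) \<le> hnorm (\<lambda>x. s i x - h x) + hnorm (\<lambda>x. h x - s j x)"
        by (rule hnorm_diff_triangle) (use sH h in auto)
      also have "\<dots> < 2 * e'"
        using N[OF ij(1)] N[OF ij(2)] hnorm_minus_commute[OF h sH, of j] by linarith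
      finally have lt: "hnorm (\<lambda>x. s i x - s j x) < 2 * e'" .
      have "M * hnorm (\<lambda>x. s i x - s j x) \<le> M * (2 * e')"
        using lt M by (intro mult_left_mono) auto
      also have "\<dots> < (M + 1) * (2 * e')" using e' by simp
      also have "\<dots> = e"
      proof -
        have "M + 1 > 0" using M by simp
        then show ?thesis unfolding e'_def by (simp add: divide_simps)
      qed
      finally show "hnorm (\<lambda>x. T (s i) x - T (s j) x) < e" using Tdiff[of i j] by simp
    qed
  qed (use TsH in auto)
  have pointwise: "(\<lambda>n. v n x) \<longlonglongrightarrow> l x"
    if "x \<in> X" "l \<in> H" "\<And>n. v n \<in> H" "(\<lambda>n. hnorm (\<lambda>x. v n x - l x)) \<longlonglongrightarrow> 0" for v :: "nat \<Rightarrow> _" and l x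
  proof (rule Lim_null_comparison[THEN LIM_zero_cancel])
    show "\<forall>\<^sub>F n in sequentially. norm (v n x - l x) \<le> hnorm (\<lambda>x. v n x - l x) * hnorm (K x)"
      by (intro always_eventually allI norm_eval_le[OF diff_closed]) (use that in auto)
    show "(\<lambda>n. hnorm (\<lambda>x. v n x - l x) * hnorm (K x)) \<longlonglongrightarrow> 0"
      using tendsto_mult_left_zero[OF that(4)] by simp
  qed
  have "u x = T h x" for x
  proof (cases "x \<in> X")
    case True
    have "(\<lambda>n. f x * s n (\<phi> x)) \<longlonglongrightarrow> f x * h (\<phi> x)"
      by (intro tendsto_intros pointwise \<phi> True h sH s(2))
    moreover have "(\<lambda>n. f x * s n (\<phi> x)) \<longlonglongrightarrow> u x"
      using pointwise[OF True u(1) TsH u(2)] True by (simp add: T)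
    ultimately show ?thesis using True LIMSEQ_unique by (auto simp: T)
  next
    case False
    then show ?thesis using zero_outside[OF u(1)] by (simp add: T)
  qed
  then have uT: "u = T h" by auto
  have "hnorm (T h) \<le> 0 + M * (0 + hnorm h)"
  proof (rule LIMSEQ_le[OF tendsto_const])
    show "(\<lambda>n. hnorm (\<lambda>x. T (s n) x - u x) + M * (hnorm (\<lambda>x. s n x - h x) + hnorm h))
        \<longlonglongrightarrow> 0 + M * (0 + hnorm h)"
      by (intro tendsto_intros u s)
    have "hnorm (T h) \<le> hnorm (\<lambda>x. T (s n) x - u x) + M * (hnorm (\<lambda>x. s n x - h x) + hnorm h)" for n
    proof -
      have "hnorm (T h) \<le> hnorm (\<lambda>x. T (s n) x - u x) + hnorm (T (s n))"
        using hnorm_le_diff[OF u(1) TsH, of n] hnorm_minus_commute[OF u(1) TsH, of n] by (simp add: uT)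
      also have "hnorm (T (s n)) \<le> M * hnorm (s n)" using span s by blast
      also have "hnorm (s n) \<le> hnorm (\<lambda>x. s n x - h x) + hnorm h"
        using hnorm_le_diff[OF sH h] .
      finally show ?thesis using M by (simp add: mult_left_mono)
    qed
    then show "\<exists>N. \<forall>n\<ge>N. hnorm (T h) \<le> hnorm (\<lambda>x. T (s n) x - u x) + M * (hnorm (\<lambda>x. s n x - h x) + hnorm h)"
      by blast
  qed
  then show ?thesis using u(1) uT by simp
qed

text \<open>On a combination of kernel functions both squared norms are kernel forms with the same
  coefficients, so the norm bound on the span is positivity of the difference kernel. In the
  application \<open>c\<close> is the conjugated weight and \<open>\<tau>\<close> the map of the
  other operator.\<close>

lemma bounded_weighted_composition:
  assumes T: "\<And>h x. T h x = (if x \<in> X then f x * h (\<phi> x) else 0)"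
    and \<phi>: "\<And>x. x \<in> X \<Longrightarrow> \<phi> x \<in> X"
    and kernel: "\<And>z. z \<in> X \<Longrightarrow> T (K z) = (\<lambda>w. c z * K (\<tau> z) w)"
    and \<tau>: "\<And>z. z \<in> X \<Longrightarrow> \<tau> z \<in> X"
    and M: "M \<ge> 0"
    and psd: "psd_on X (\<lambda>z w. of_real (M\<^sup>2) * K z w - c z * cnj (c w) * K (\<tau> z) (\<tau> w))"
  shows "bounded_operator_on H ip T"
proof -
  have ext: "T h \<in> H \<and> hnorm (T h) \<le> M * hnorm h" if "h \<in> H" for h
  proof (rule weighted_composition_extends_from_span[of T f \<phi> M h, OF T \<phi> M _ that])
    fix k assume "k \<in> kernel_span"
    then obtain F a where F: "finite F" "F \<subseteq> X" "k = (\<lambda>x. \<Sum>z\<in>F. a z * K z x)"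
      unfolding kernel_span_def by blast
    have "T k = (\<lambda>x. \<Sum>z\<in>F. a z * T (K z) x)"
      by (auto simp: F(3) T sum_distrib_left mult_ac)
    also have "\<dots> = (\<lambda>x. \<Sum>z\<in>F. a z * (c z * K (\<tau> z) x))"
      using F by (intro ext sum.cong) (auto simp: kernel)
    finally have Tk: "T k = (\<lambda>x. \<Sum>z\<in>F. a z * (c z * K (\<tau> z) x))" .
    have vH: "z \<in> F \<Longrightarrow> (\<lambda>x. c z * K (\<tau> z) x) \<in> H" for z
      using F \<tau> by (auto intro!: scale_closed kernel_closed)
    have TkH: "T k \<in> H"
      unfolding Tk by (rule sum_closed) (use vH scale_closed in blast)
    have kH: "k \<in> H" using \<open>k \<in> kernel_span\<close> kernel_span_subset by auto
    have "ip k k = kernel_form F (\<lambda>z w. ip (K z) (K w)) a"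
      unfolding F(3) by (rule ip_linear_combination) (use F kernel_closed in auto)
    also have "\<dots> = kernel_form F K a"
      by (rule kernel_form_cong) (use F in \<open>auto intro!: reproducing kernel_closed\<close>)
    finally have kk: "ip k k = kernel_form F K a" .
    have "ip (T k) (T k) = kernel_form F (\<lambda>z w. ip (\<lambda>x. c z * K (\<tau> z) x) (\<lambda>x. c w * K (\<tau> w) x)) a"
      unfolding Tk by (rule ip_linear_combination) (use vH in auto)
    also have "\<dots> = kernel_form F (\<lambda>z w. c z * cnj (c w) * K (\<tau> z) (\<tau> w)) a"
    proof (rule kernel_form_cong)
      fix z w assume "z \<in> F" "w \<in> F"
      then have "K (\<tau> z) \<in> H" "K (\<tau> w) \<in> H" "\<tau> w \<in> X" using F \<tau> kernel_closed by auto
      then show "ip (\<lambda>x. c z * K (\<tau> z) x) (\<lambda>x. c w * K (\<tau> w) x) = c z * cnj (c w) * K (\<tau> z) (\<tau> w)"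
        by (simp add: ip_scale ip_scale_right scale_closed reproducing)
    qed
    finally have "of_real (M\<^sup>2) * ip k k - ip (T k) (T k)
        = kernel_form F (\<lambda>z w. of_real (M\<^sup>2) * K z w - c z * cnj (c w) * K (\<tau> z) (\<tau> w)) a"
      by (simp add: kk kernel_form_def sum_subtractf sum_distrib_left algebra_simps)
    then have "0 \<le> of_real (M\<^sup>2) * ip k k - ip (T k) (T k)"
      using psd_onD[OF psd F(1,2)] by simp
    then have "(hnorm (T k))\<^sup>2 \<le> (M * hnorm k)\<^sup>2"
      by (simp add: less_eq_complex_def ip_self[OF kH] ip_self[OF TkH] power_mult_distrib
          flip: of_real_power)
    then have "hnorm (T k) \<le> M * hnorm k"
      by (rule power2_le_imp_le) (simp add: M kH hnorm_nonneg)
    with TkH show "T k \<in> H \<and> hnorm (T k) \<le> M * hnorm k" ..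
  qed
  show ?thesis
    unfolding bounded_operator_on_def
    using ext by (auto simp: T fun_eq_iff algebra_simps simp flip: hnorm_def)
qed

text \<open>For fixed \<open>k\<close> the defect \<open>E\<close> is linear and bounded and
  vanishes on kernel functions; density of their span makes it zero.\<close>

lemma is_adjoint_onI:
  assumes T: "bounded_operator_on H ip T" and S: "bounded_operator_on H ip S"
    and kernel: "\<And>z k. z \<in> X \<Longrightarrow> k \<in> H \<Longrightarrow> ip (T (K z)) k = cnj (S k z)"
  shows "is_adjoint_on H ip T S"
  unfolding is_adjoint_on_def
proof (intro ballI)
  fix h k assume h: "h \<in> H" and k: "k \<in> H"
  have TH: "T h \<in> H" if "h \<in> H" for h using T that by (auto simp: bounded_operator_on_def)
  have SH: "S h \<in> H" if "h \<in> H" for h using S that by (auto simp: bounded_operator_on_def)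
  have Tadd: "T (\<lambda>x. h x + k x) = (\<lambda>x. T h x + T k x)" if "h \<in> H" "k \<in> H" for h k
    using T that by (auto simp: bounded_operator_on_def)
  have Tscale: "T (\<lambda>x. c * h x) = (\<lambda>x. c * T h x)" if "h \<in> H" for h c
    using T that by (auto simp: bounded_operator_on_def)
  have "\<exists>M. \<forall>h\<in>H. hnorm (T h) \<le> M * hnorm h"
    using T unfolding bounded_operator_on_def hnorm_def by blast
  then obtain M where M: "\<And>h. h \<in> H \<Longrightarrow> hnorm (T h) \<le> M * hnorm h" by blast
  define E where "E h = ip (T h) k - ip h (S k)" for h
  have E_add: "E (\<lambda>x. h x + l x) = E h + E l" if "h \<in> H" "l \<in> H" for h l
    using that k by (simp add: E_def Tadd ip_add TH SH)
  have E_scale: "E (\<lambda>x. c * h x) = c * E h" if "h \<in> H" for c h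
    using that k by (simp add: E_def Tscale ip_scale TH SH algebra_simps)
  have E_zero: "E (\<lambda>_. 0) = 0" using E_scale[OF zero_closed, of 0] by simp
  have E_kernel: "E (K z) = 0" if "z \<in> X" for z
    using kernel[OF that k] ip_kernel_left[OF SH[OF k] that] by (simp add: E_def)
  have E_span: "E s = 0" if s: "s \<in> kernel_span" for s
  proof -
    obtain F a where F: "finite F" "F \<subseteq> X" "s = (\<lambda>x. \<Sum>z\<in>F. a z * K z x)"
      using s unfolding kernel_span_def by blast
    have "E (\<lambda>x. \<Sum>z\<in>F. a z * K z x) = 0"
      using F(1,2)
    proof (induction F rule: finite_induct)
      case (insert z F)
      have "(\<lambda>x. \<Sum>z\<in>F. a z * K z x) \<in> H"
        using insert.prems by (auto intro!: sum_closed scale_closed kernel_closed)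
      then show ?case
        using insert kernel_closed[of z]
        by (simp add: E_add[of "\<lambda>x. a z * K z x"] E_scale E_kernel scale_closed)
    qed (simp add: E_zero)
    then show ?thesis using F by simp
  qed
  obtain s where s: "\<And>n :: nat. s n \<in> kernel_span" "(\<lambda>n. hnorm (\<lambda>x. s n x - h x)) \<longlonglongrightarrow> 0"
    using kernel_span_dense[OF h] by blast
  have sH: "s n \<in> H" for n using s kernel_span_subset by auto
  have "norm (E h) \<le> (M * hnorm k + hnorm (S k)) * hnorm (\<lambda>x. s n x - h x)" for n
  proof -
    let ?v = "\<lambda>x. s n x - h x"
    have v: "?v \<in> H" by (rule diff_closed[OF sH h])
    have "E (s n) = E (\<lambda>x. ?v x + h x)" by simp
    also have "\<dots> = E ?v + E h" by (rule E_add[OF v h])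
    finally have "E h = - E ?v" using E_span[OF s(1)[of n]] by (simp add: add_eq_0_iff)
    then have "norm (E h) = norm (E ?v)" by simp
    also have "\<dots> \<le> norm (ip (T ?v) k) + norm (ip ?v (S k))"
      unfolding E_def by (rule norm_triangle_ineq4)
    also have "norm (ip (T ?v) k) \<le> hnorm (T ?v) * hnorm k"
      by (rule Cauchy_Schwarz[OF TH[OF v] k])
    also have "hnorm (T ?v) * hnorm k \<le> (M * hnorm ?v) * hnorm k"
      by (intro mult_right_mono M v hnorm_nonneg k)
    also have "norm (ip ?v (S k)) \<le> hnorm ?v * hnorm (S k)"
      by (rule Cauchy_Schwarz[OF v SH[OF k]])
    finally show ?thesis by (simp add: algebra_simps)
  qed
  moreover have "(\<lambda>n. (M * hnorm k + hnorm (S k)) * hnorm (\<lambda>x. s n x - h x)) \<longlonglongrightarrow> 0"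
    using tendsto_mult_right_zero[OF s(2)] .
  ultimately have "norm (E h) \<le> 0"
    by (intro LIMSEQ_le_const[of _ 0]) auto
  then show "ip (T h) k = ip h (S k)" by (simp add: E_def)
qed

end

section \<open>The kernel identity on the ball\<close>

lemma analytic_fun_on_imp_continuous_on:
  "analytic_fun_on f S \<Longrightarrow> continuous_on S f"
  unfolding analytic_fun_on_def
  by (intro continuous_at_imp_continuous_on) (blast intro: has_derivative_continuous)

lemma analytic_self_map_on_imp_continuous_on:
  assumes "analytic_self_map_on \<phi> S"
  shows "continuous_on S \<phi>"
proof -
  have "continuous_on S (\<lambda>z. \<chi> i. \<phi> z $ i)"
    using assms unfolding analytic_self_map_on_def analytic_map_on_def
    by (intro continuous_on_vec_lambda analytic_fun_on_imp_continuous_on) auto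
  then show ?thesis by simp
qed

text \<open>The values of \<open>h\<close> lie in the discrete set of integer multiples of 2 pi i,
  so \<open>h\<close> is constant. This is how equal powers yield equal bases and sums of principal
  logarithms are kept on one branch.\<close>

lemma zero_if_exp_eq_1_connected:
  fixes h :: "'a :: topological_space \<Rightarrow> complex"
  assumes S: "connected S" and h: "continuous_on S h"
    and exp: "\<And>x. x \<in> S \<Longrightarrow> exp (h x) = 1"
    and x0: "x0 \<in> S" "h x0 = 0" and x: "x \<in> S"
  shows "h x = 0"
proof -
  have "h constant_on S"
  proof (rule continuous_discrete_range_constant[OF S h])
    fix x assume "x \<in> S"
    have "1 \<le> norm (h y - h x)" if "y \<in> S" "h y \<noteq> h x" for y
    proof -
      obtain m n :: int where Im: "Im (h x) = of_int (2 * m) * pi" "Im (h y) = of_int (2 * n) * pi"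
        and Re: "Re (h x) = 0" "Re (h y) = 0"
        using exp[OF \<open>x \<in> S\<close>] exp[OF \<open>y \<in> S\<close>] unfolding exp_eq_1 by blast
      then have "m \<noteq> n" using that(2) by (auto simp: complex_eq_iff)
      then have "1 \<le> \<bar>real_of_int (n - m)\<bar>" by linarith
      then have "1 * 1 \<le> \<bar>real_of_int (n - m)\<bar> * (2 * pi)"
        using pi_ge_two by (intro mult_mono) auto
      also have "\<dots> = \<bar>real_of_int (n - m) * (2 * pi)\<bar>"
        by (simp add: abs_mult)
      also have "real_of_int (n - m) * (2 * pi) = Im (h y - h x)"
        by (simp add: Im algebra_simps)
      finally show ?thesis using abs_Im_le_cmod[of "h y - h x"] by simp
    qed
    then show "\<exists>e>0. \<forall>y. y \<in> S \<and> h y \<noteq> h x \<longrightarrow> e \<le> norm (h y - h x)"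
      by (intro exI[of _ 1]) auto
  qed
  then show ?thesis using x0 x by (auto simp: constant_on_def)
qed

section \<open>Kernels and logarithms on the ball\<close>

lemma Re_pos_not_nonpos_Reals: "0 < Re z \<Longrightarrow> z \<notin> \<real>\<^sub>\<le>\<^sub>0"
  by (auto simp: complex_nonpos_Reals_iff)

lemma continuous_on_Ln_right_half_plane:
  "continuous_on S p \<Longrightarrow> (\<And>x. x \<in> S \<Longrightarrow> 0 < Re (p x)) \<Longrightarrow> continuous_on S (\<lambda>x. Ln (p x))"
  by (intro continuous_on_Ln') (use Re_pos_not_nonpos_Reals in auto)

lemma Re_one_minus_hinner_pos:
  "z \<in> unit_ball \<Longrightarrow> w \<in> unit_ball \<Longrightarrow> 0 < Re (1 - hinner z w)"
  by (intro Re_one_minus_pos hinner_ball_less_1)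

lemma one_minus_hinner_nonzero:
  "z \<in> unit_ball \<Longrightarrow> w \<in> unit_ball \<Longrightarrow> 1 - hinner z w \<noteq> 0"
  using Re_one_minus_hinner_pos[of z w] by force

lemma ball_kernel_exp:
  assumes "z \<in> unit_ball" "w \<in> unit_ball"
  shows "ball_kernel \<gamma> z w = exp (- of_real \<gamma> * Ln (1 - hinner w z))"
  using assms one_minus_hinner_nonzero[of w z] by (simp add: ball_kernel_def powr_def)

lemma cnj_ball_kernel:
  assumes "z \<in> unit_ball" "w \<in> unit_ball"
  shows "cnj (ball_kernel \<gamma> z w) = ball_kernel \<gamma> w z"
  using assms Re_pos_not_nonpos_Reals[OF Re_one_minus_hinner_pos[OF assms(2,1)]]
  by (simp add: ball_kernel_exp exp_cnj cnj_Ln cnj_hinner)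

lemma ball_kernel_at_zero:
  "w \<in> unit_ball \<Longrightarrow> ball_kernel \<gamma> 0 w = 1" "z \<in> unit_ball \<Longrightarrow> ball_kernel \<gamma> z 0 = 1"
  by (simp_all add: ball_kernel_def)

text \<open>With \<open>h\<close> a logarithm of the quotient of the two products, the sides say
  that -\<gamma> times \<open>h z\<close>, respectively \<open>h z\<close>, has exponential 1. As
  \<open>h\<close> is continuous with \<open>h 0 = 0\<close>, either one means \<open>h = 0\<close>
  on the ball. Each side keeps its own quantifier over \<open>z\<close> because the argument uses
  the whole ball.\<close>

lemma ball_kernel_product_iff:
  fixes w u c :: "complex ^ 'n"
  assumes \<gamma>: "\<gamma> \<noteq> 0"
    and ball: "w \<in> unit_ball" "u \<in> unit_ball" "c \<in> unit_ball"
    and \<phi>: "continuous_on unit_ball \<phi>" "\<And>z. z \<in> unit_ball \<Longrightarrow> \<phi> z \<in> unit_ball"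
  shows "(\<forall>z\<in>unit_ball. ball_kernel \<gamma> (\<phi> 0) w * ball_kernel \<gamma> z u
           = ball_kernel \<gamma> z c * ball_kernel \<gamma> (\<phi> z) w) \<longleftrightarrow>
         (\<forall>z\<in>unit_ball. (1 - hinner w (\<phi> 0)) * (1 - hinner u z)
           = (1 - hinner c z) * (1 - hinner w (\<phi> z)))"
proof -
  let ?B = "unit_ball :: (complex ^ 'n) set"
  have 0: "0 \<in> ?B" by simp
  define h where "h z = Ln (1 - hinner w (\<phi> 0)) + Ln (1 - hinner u z)
     - Ln (1 - hinner c z) - Ln (1 - hinner w (\<phi> z))" for z
  have conn: "connected ?B" by simp
  have cont: "continuous_on ?B h"
    unfolding h_def
    by (intro continuous_intros continuous_on_Ln_right_half_plane \<phi> Re_one_minus_hinner_pos ball)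
       auto
  have h0: "h 0 = 0" by (simp add: h_def)
  have kernel: "ball_kernel \<gamma> (\<phi> 0) w * ball_kernel \<gamma> z u = ball_kernel \<gamma> z c * ball_kernel \<gamma> (\<phi> z) w
      \<longleftrightarrow> exp (- of_real \<gamma> * h z) = 1" if "z \<in> ?B" for z
  proof -
    have "exp a * exp b = exp a' * exp b' \<longleftrightarrow> exp (a + b - a' - b') = 1" for a b a' b' :: complex
      by (simp add: exp_diff exp_add field_simps)
    moreover have "- of_real \<gamma> * h z = - of_real \<gamma> * Ln (1 - hinner w (\<phi> 0))
        + - of_real \<gamma> * Ln (1 - hinner u z) - - of_real \<gamma> * Ln (1 - hinner c z)
        - - of_real \<gamma> * Ln (1 - hinner w (\<phi> z))"
      by (simp add: h_def algebra_simps)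
    ultimately show ?thesis
      unfolding ball_kernel_exp[OF \<phi>(2)[OF 0] ball(1)] ball_kernel_exp[OF that ball(2)]
        ball_kernel_exp[OF that ball(3)] ball_kernel_exp[OF \<phi>(2)[OF that] ball(1)] by (simp only:)
  qed
  have poly: "(1 - hinner w (\<phi> 0)) * (1 - hinner u z) = (1 - hinner c z) * (1 - hinner w (\<phi> z))
      \<longleftrightarrow> exp (h z) = 1" if "z \<in> ?B" for z
    using one_minus_hinner_nonzero[OF ball(1) \<phi>(2)[OF 0]] one_minus_hinner_nonzero[OF ball(2) that]
      one_minus_hinner_nonzero[OF ball(3) that] one_minus_hinner_nonzero[OF ball(1) \<phi>(2)[OF that]]
    by (simp add: h_def exp_diff exp_add divide_simps)
  show ?thesis
  proof
    assume L: "\<forall>z\<in>?B. ball_kernel \<gamma> (\<phi> 0) w * ball_kernel \<gamma> z u = ball_kernel \<gamma> z c * ball_kernel \<gamma> (\<phi> z) w"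
    have "- of_real \<gamma> * h z = 0" if "z \<in> ?B" for z
      by (rule zero_if_exp_eq_1_connected[OF conn _ _ 0 _ that])
         (use L kernel cont h0 in \<open>auto intro!: continuous_intros\<close>)
    then show "\<forall>z\<in>?B. (1 - hinner w (\<phi> 0)) * (1 - hinner u z) = (1 - hinner c z) * (1 - hinner w (\<phi> z))"
      using \<gamma> poly by simp
  next
    assume R: "\<forall>z\<in>?B. (1 - hinner w (\<phi> 0)) * (1 - hinner u z) = (1 - hinner c z) * (1 - hinner w (\<phi> z))"
    have "h z = 0" if "z \<in> ?B" for z
      by (rule zero_if_exp_eq_1_connected[OF conn cont _ 0 h0 that]) (use R poly in auto)
    then show "\<forall>z\<in>?B. ball_kernel \<gamma> (\<phi> 0) w * ball_kernel \<gamma> z u = ball_kernel \<gamma> z c * ball_kernel \<gamma> (\<phi> z) w"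
      using kernel by simp
  qed
qed

text \<open>\<open>P\<close> and \<open>Q\<close> are the numerators without their constant terms,
  and the identity reads \<open>hinner (P w) z = hinner w (Q z)\<close>. Such mutually adjoint maps
  are linear: finitely many \<open>w\<close> already express each coordinate of \<open>Q z\<close>
  linearly in \<open>z\<close>.\<close>

lemma linear_fractional_pair_if_product_identity:
  fixes \<phi> \<psi> :: "complex ^ 'n \<Rightarrow> complex ^ 'n"
  assumes ball: "c \<in> unit_ball" "d \<in> unit_ball"
    and eq: "\<And>z w. z \<in> unit_ball \<Longrightarrow> w \<in> unit_ball \<Longrightarrow>
      (1 - hinner w d) * (1 - hinner (\<psi> w) z) = (1 - hinner c z) * (1 - hinner w (\<phi> z))"
  shows "\<exists>A :: complex ^ 'n ^ 'n.
      (\<forall>z\<in>unit_ball. \<phi> z = (1 / (1 - hinner z c)) *s (d + A *v z)) \<and>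
      (\<forall>z\<in>unit_ball. \<psi> z = (1 / (1 - hinner z d)) *s (c + conj_transpose A *v z))"
proof -
  let ?B = "unit_ball :: (complex ^ 'n) set"
  define P where "P w = (1 - hinner w d) *s \<psi> w - c" for w
  define Q where "Q z = (1 - hinner z c) *s \<phi> z - d" for z
  have PQ: "hinner (P w) z = hinner w (Q z)" if "z \<in> ?B" "w \<in> ?B" for z w
  proof -
    have "hinner (P w) z = (1 - hinner w d) * hinner (\<psi> w) z - hinner c z"
      by (simp only: P_def hinner_diff_left hinner_scale_left)
    moreover have "hinner w (Q z) = (1 - hinner c z) * hinner w (\<phi> z) - hinner w d"
      by (simp only: Q_def hinner_diff_right hinner_scale_right cnj_hinner complex_cnj_diff complex_cnj_one)
    ultimately show ?thesis using eq[OF that] by algebra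
  qed
  \<comment> \<open>Halved, since the standard basis vectors lie outside the open ball; the factor 2
    in \<open>A\<close> undoes this.\<close>
  define e where "e j = (\<chi> i. if i = j then 1 / 2 else (0 :: complex))" for j :: 'n
  have he: "hinner (e j) y = (1 / 2) * cnj (y $ j)" for j y
    by (simp add: hinner_def e_def if_distrib[of "\<lambda>x. x * _"] cong: if_cong)
  have e: "e j \<in> ?B" for j
  proof -
    have "hinner (e j) (e j) = 1 / 4" by (simp add: he) (simp add: e_def)
    then have "(norm (e j))\<^sup>2 = 1 / 4"
      unfolding hinner_self by (metis of_real_1 of_real_divide of_real_eq_iff of_real_numeral)
    then have "(norm (e j))\<^sup>2 < 1\<^sup>2" by simp
    then show ?thesis using power2_less_imp_less[of "norm (e j)" 1] by simp
  qed
  define A :: "complex ^ 'n ^ 'n" where "A = (\<chi> j k. 2 * cnj (P (e j) $ k))"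
  have QA: "Q z = A *v z" if "z \<in> ?B" for z
  proof (rule vec_eq_iff[THEN iffD2], rule allI)
    fix j
    have "cnj (Q z $ j) = 2 * hinner (P (e j)) z"
      using PQ[OF that e, of j] by (simp add: he mult.commute)
    then have "Q z $ j = cnj (2 * hinner (P (e j)) z)"
      by (metis complex_cnj_cnj)
    also have "\<dots> = 2 * hinner z (P (e j))"
      by (simp add: cnj_hinner)
    also have "\<dots> = (A *v z) $ j"
      by (simp add: A_def matrix_vector_mult_def hinner_def sum_distrib_left mult_ac)
    finally show "Q z $ j = (A *v z) $ j" .
  qed
  have PA: "P w = conj_transpose A *v w" if "w \<in> ?B" for w
  proof (rule vec_eqI_hinner_ball)
    fix z :: "complex ^ 'n" assume z: "z \<in> ?B"
    have "hinner (P w) z = hinner w (A *v z)" using PQ[OF z that] QA[OF z] by simp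
    also have "\<dots> = cnj (hinner (A *v z) w)" by (simp add: cnj_hinner)
    also have "\<dots> = hinner (conj_transpose A *v w) z" by (simp only: hinner_conj_transpose cnj_hinner)
    finally show "hinner (P w) z = hinner (conj_transpose A *v w) z" .
  qed
  have solve: "u = (1 / e) *s v" if "e *s u = v" "e \<noteq> 0" for e and u v :: "complex ^ 'n"
    using that by (auto simp: vector_smult_assoc)
  show ?thesis
  proof (intro exI conjI ballI)
    fix z assume z: "z \<in> ?B"
    have "(1 - hinner z c) *s \<phi> z = d + A *v z"
      using QA[OF z] by (simp add: Q_def diff_eq_eq add.commute)
    then show "\<phi> z = (1 / (1 - hinner z c)) *s (d + A *v z)"
      by (rule solve[OF _ one_minus_hinner_nonzero[OF z ball(1)]])
    have "(1 - hinner z d) *s \<psi> z = c + conj_transpose A *v z"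
      using PA[OF z] by (simp add: P_def diff_eq_eq add.commute)
    then show "\<psi> z = (1 / (1 - hinner z d)) *s (c + conj_transpose A *v z)"
      by (rule solve[OF _ one_minus_hinner_nonzero[OF z ball(2)]])
  qed
qed

text \<open>Once denominators are cleared, both sides are
  \<open>1 - hinner w d - hinner c z - hinner w (A *v z)\<close>.\<close>

lemma product_identity_if_linear_fractional_pair:
  fixes c d z w u v :: "complex ^ 'n"
  assumes ball: "c \<in> unit_ball" "d \<in> unit_ball" "z \<in> unit_ball" "w \<in> unit_ball"
    and u: "u = (1 / (1 - hinner z c)) *s (d + A *v z)"
    and v: "v = (1 / (1 - hinner w d)) *s (c + conj_transpose A *v w)"
  shows "(1 - hinner w d) * (1 - hinner v z) = (1 - hinner c z) * (1 - hinner w u)"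
proof -
  have nz: "1 - hinner w d \<noteq> 0" "1 - hinner c z \<noteq> 0"
    using one_minus_hinner_nonzero ball by blast+
  have adj: "hinner (conj_transpose A *v w) z = hinner w (A *v z)"
    by (metis cnj_hinner hinner_conj_transpose)
  have cancel: "e * (1 / e * x) = x" if "e \<noteq> 0" for e x :: complex
    using that by simp
  have left: "(1 - hinner w d) * hinner v z = hinner c z + hinner w (A *v z)"
    unfolding v hinner_scale_left cancel[OF nz(1)] by (simp only: hinner_add_left adj)
  have right: "(1 - hinner c z) * hinner w u = hinner w d + hinner w (A *v z)"
    unfolding u hinner_scale_right complex_cnj_divide complex_cnj_one complex_cnj_diff cnj_hinner
      cancel[OF nz(2)] by (rule hinner_add_right)
  show ?thesis
    unfolding right_diff_distrib[of "1 - _"] left right by simp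
qed

section \<open>Boundedness\<close>

text \<open>The subtracted kernel is the Gram kernel of the images of the kernel functions under the
  operator with weight \<open>g\<close> and map \<open>\<psi>\<close>. That operator sends the
  kernel at \<open>z\<close> to \<open>cnj (f z)\<close> times the kernel at
  \<open>\<phi> z\<close>, so its boundedness is read off from \<open>f\<close> and
  \<open>\<phi>\<close>.\<close>

lemma psd_on_weighted_ball_kernel:
  fixes \<phi> :: "complex ^ 'n \<Rightarrow> complex ^ 'n" and A :: "complex ^ 'n ^ 'n"
  assumes \<gamma>: "\<gamma> > 0" and c: "c \<in> unit_ball" and d: "d \<in> unit_ball"
    and \<phi>_ball: "\<And>z. z \<in> unit_ball \<Longrightarrow> \<phi> z \<in> unit_ball"
    and cont: "continuous_on unit_ball \<phi>"
    and \<phi>: "\<And>z. z \<in> unit_ball \<Longrightarrow> \<phi> z = (1 / (1 - hinner z c)) *s (d + A *v z)"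
  obtains M where "M \<ge> 0"
    "psd_on unit_ball (\<lambda>z w. of_real (M\<^sup>2) * ball_kernel \<gamma> z w
       - cnj (\<alpha> * ball_kernel \<gamma> c z) * cnj (cnj (\<alpha> * ball_kernel \<gamma> c w)) * ball_kernel \<gamma> (\<phi> z) (\<phi> w))"
proof -
  let ?B = "unit_ball :: (complex ^ 'n) set"
  define E where "E z = 1 - hinner z c" for z
  define V where "V z = d + A *v z" for z
  define G where "G z w = 1 - hinner (\<phi> w) (\<phi> z)" for z w
  have ReE: "0 < Re (E z)" if "z \<in> ?B" for z
    unfolding E_def using Re_one_minus_hinner_pos[OF that c] .
  have ReG: "0 < Re (G z w)" if "z \<in> ?B" "w \<in> ?B" for z w
    unfolding G_def using Re_one_minus_hinner_pos \<phi>_ball that by blast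
  have E_nz: "E z \<noteq> 0" if "z \<in> ?B" for z using ReE[OF that] by force
  have G_nz: "G z w \<noteq> 0" if "z \<in> ?B" "w \<in> ?B" for z w using ReG[OF that] by force
  have V_eq: "V z = E z *s \<phi> z" if "z \<in> ?B" for z
    using E_nz[OF that] \<phi>[OF that] by (simp add: V_def E_def[symmetric] vector_smult_assoc)
  have hV: "hinner (V w) (V z) = E w * cnj (E z) * hinner (\<phi> w) (\<phi> z)"
    if "z \<in> ?B" "w \<in> ?B" for z w
    using that by (simp add: V_eq hinner_scale_left hinner_scale_right mult_ac)

  have "norm (d + A *v z) < norm (1 - hinner z c)" if "z \<in> ?B" for z
  proof -
    have "norm (V z) = norm (E z) * norm (\<phi> z)" by (simp add: V_eq[OF that] norm_scale_vec)
    also have "\<dots> < norm (E z) * 1"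
      using \<phi>_ball[OF that] E_nz[OF that] by (intro mult_strict_left_mono) auto
    finally show ?thesis by (simp add: V_def E_def)
  qed
  then obtain l where l: "l > 0" and form: "\<And>y0 y. l * ((norm y0)\<^sup>2 - (norm y)\<^sup>2)
      \<le> (norm (y0 - hinner y c))\<^sup>2 - (norm (y0 *s d + A *v y))\<^sup>2"
    using cone_map_form_bound[OF c d] by blast

  \<comment> \<open>The polarisation of \<open>form\<close>: its kernel form at \<open>a\<close> is
    the inequality evaluated at the \<open>(y0, y)\<close> defined below.\<close>
  define P where "P z w = cnj (E z) * E w - hinner (V w) (V z) - of_real l * (1 - hinner w z)" for z w
  have psd_P: "psd_on ?B P"
  proof (rule psd_onI)
    fix F :: "(complex ^ 'n) set" and a :: "complex ^ 'n \<Rightarrow> complex"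
    define y0 where "y0 = (\<Sum>w\<in>F. cnj (a w))"
    define y where "y = (\<Sum>w\<in>F. cnj (a w) *s w)"
    have X: "y0 - hinner y c = (\<Sum>w\<in>F. cnj (a w) * E w)"
      by (simp add: y0_def y_def E_def hinner_sum_left hinner_scale_left right_diff_distrib sum_subtractf)
    have Y: "y0 *s d + A *v y = (\<Sum>w\<in>F. cnj (a w) *s V w)"
    proof -
      have "y0 *s d = (\<Sum>w\<in>F. cnj (a w) *s d)"
        by (simp add: y0_def vec_eq_iff sum_distrib_right)
      moreover have "A *v y = (\<Sum>w\<in>F. cnj (a w) *s (A *v w))"
        by (simp add: y_def vec.linear_sum[OF matrix_vector_mul_linear_gen] vector_scalar_commute)
      ultimately show ?thesis
        by (simp add: V_def vec.scale_right_distrib sum.distrib)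
    qed
    have gram: "of_real ((norm (\<Sum>w\<in>F. cnj (a w) *s v w))\<^sup>2)
        = (\<Sum>z\<in>F. \<Sum>w\<in>F. a z * cnj (a w) * hinner (v w) (v z))" for v
      unfolding hinner_self[symmetric] unfolding hinner_sum_right unfolding hinner_sum_left
      by (simp add: hinner_scale_left hinner_scale_right mult_ac)
    have gram1: "of_real ((norm (\<Sum>w\<in>F. cnj (a w) * v w))\<^sup>2)
        = (\<Sum>z\<in>F. \<Sum>w\<in>F. a z * cnj (a w) * (cnj (v z) * v w))" for v :: "_ \<Rightarrow> complex"
    proof -
      have "of_real ((norm (\<Sum>w\<in>F. cnj (a w) * v w))\<^sup>2)
          = cnj (\<Sum>w\<in>F. cnj (a w) * v w) * (\<Sum>w\<in>F. cnj (a w) * v w)"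
        by (simp only: complex_norm_square mult.commute)
      also have "\<dots> = (\<Sum>z\<in>F. \<Sum>w\<in>F. (a z * cnj (v z)) * (cnj (a w) * v w))"
        by (simp add: sum_product)
      finally show ?thesis by (simp add: mult_ac)
    qed
    have "kernel_form F P a =
        of_real ((norm (y0 - hinner y c))\<^sup>2) - of_real ((norm (y0 *s d + A *v y))\<^sup>2)
        - of_real l * (of_real ((norm y0)\<^sup>2) - of_real ((norm y)\<^sup>2))"
      unfolding X Y gram gram1
      using gram[of "\<lambda>w. w"] gram1[of "\<lambda>_. 1"]
      by (simp add: y0_def y_def kernel_form_def P_def right_diff_distrib sum_subtractf sum_distrib_left mult_ac)
    also have "\<dots> = of_real ((norm (y0 - hinner y c))\<^sup>2 - (norm (y0 *s d + A *v y))\<^sup>2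
        - l * ((norm y0)\<^sup>2 - (norm y)\<^sup>2))"
      by simp
    finally show "0 \<le> kernel_form F P a"
      using form[of y0 y] by (simp only: less_eq_complex_def Re_complex_of_real Im_complex_of_real zero_complex.sel) simp
  qed

  \<comment> \<open>Dividing by \<open>G\<close> multiplies by a kernel that is positive
    semidefinite by the case of exponent 1; dividing by the two factors \<open>E\<close> is a
    rank-one multiplication.\<close>
  define S where "S z w = P z w / (cnj (E z) * E w * G z w)" for z w
  have one_minus_S: "1 - S z w = of_real l * (1 - hinner w z) / (cnj (E z) * E w * G z w)"
    if "z \<in> ?B" "w \<in> ?B" for z w
  proof -
    have "P z w = cnj (E z) * E w * G z w - of_real l * (1 - hinner w z)"
      using hV[OF that] by (simp add: P_def G_def algebra_simps)
    then show ?thesis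
      using E_nz[OF that(1)] E_nz[OF that(2)] G_nz[OF that] by (simp add: S_def diff_divide_distrib)
  qed
  have psd_S: "psd_on ?B S"
  proof -
    have inv: "(1 - x) powr (- of_real 1) = 1 / (1 - x)" if "1 - x \<noteq> 0" for x :: complex
      using that by (simp add: powr_def exp_minus field_simps)
    have lt: "norm (hinner (\<phi> w) (\<phi> z)) < 1" if "z \<in> ?B" "w \<in> ?B" for z w
      using hinner_ball_less_1 \<phi>_ball that by blast
    have "psd_on ?B (\<lambda>z w. (1 - hinner (\<phi> w) (\<phi> z)) powr (- of_real 1))"
      by (rule psd_on_one_minus_powr[OF psd_on_hinner lt]) auto
    from psd_on_rank_one_mult[OF psd_on_mult[OF psd_P this], of "\<lambda>z. cnj (1 / E z)"]
    show ?thesis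
    proof (rule psd_on_cong)
      fix z w assume zw: "z \<in> ?B" "w \<in> ?B"
      show "cnj (1 / E z) * cnj (cnj (1 / E w)) * (P z w * (1 - hinner (\<phi> w) (\<phi> z)) powr - of_real 1) = S z w"
        using inv[of "hinner (\<phi> w) (\<phi> z)"] G_nz[OF zw] by (simp add: S_def G_def mult_ac)
    qed
  qed
  \<comment> \<open>On the diagonal \<open>1 - S z z\<close> is a quotient of positive numbers; the
    minor bound carries the estimate to all pairs.\<close>
  have S_lt: "norm (S z w) < 1" if "z \<in> ?B" "w \<in> ?B" for z w
  proof -
    have diag: "0 \<le> Re (S z z) \<and> Re (S z z) < 1" if z: "z \<in> ?B" for z
    proof -
      have "0 \<le> Re (S z z)" using psd_on_diag[OF psd_S z] by (simp add: less_eq_complex_def)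
      moreover have "1 - S z z = of_real (l * (1 - (norm z)\<^sup>2) / ((norm (E z))\<^sup>2 * (1 - (norm (\<phi> z))\<^sup>2)))"
        unfolding one_minus_S[OF z z] G_def hinner_self mult.commute[of "cnj (E z)" "E z"]
        unfolding complex_norm_square[symmetric] by simp
      moreover have "l * (1 - (norm z)\<^sup>2) / ((norm (E z))\<^sup>2 * (1 - (norm (\<phi> z))\<^sup>2)) > 0"
        using l z \<phi>_ball[OF z] E_nz[OF z]
        by (intro divide_pos_pos mult_pos_pos) (auto simp: power_less_one_iff)
      ultimately show ?thesis
        by (metis Re_complex_of_real diff_gt_0_iff_gt minus_complex.sel(1) one_complex.sel(1))
    qed
    have "(norm (S z w))\<^sup>2 \<le> Re (S z z) * Re (S w w)" by (rule psd_on_norm_le[OF psd_S that])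
    also have "\<dots> < 1 * 1" using diag[OF that(1)] diag[OF that(2)] by (intro mult_strict_mono) auto
    finally have "(norm (S z w))\<^sup>2 < 1\<^sup>2" by simp
    then show ?thesis by (rule power2_less_imp_less) simp
  qed

  \<comment> \<open>Principal logarithms need not add. Here every complex logarithm has its argument
    in the right half-plane, so the difference is continuous on the connected product of balls, and
    at \<open>(0, 0)\<close> all arguments are positive reals.\<close>
  have Ln_eq: "Ln (1 - hinner w z) + of_real (ln l)
      = Ln (E w) + cnj (Ln (E z)) + Ln (G z w) + Ln (1 - S z w)"
    if zw: "z \<in> ?B" "w \<in> ?B" for z w
  proof -
    define h where "h p = Ln (1 - hinner (snd p) (fst p)) + of_real (ln l)
       - Ln (E (snd p)) - cnj (Ln (E (fst p))) - Ln (G (fst p) (snd p)) - Ln (1 - S (fst p) (snd p))" for p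
    have "h (z, w) = 0"
    proof (rule zero_if_exp_eq_1_connected[of "?B \<times> ?B" h])
      show "connected (?B \<times> ?B)" by (intro connected_Times) auto
      have cont_fst: "continuous_on (?B \<times> ?B) (\<lambda>p. \<phi> (fst p))"
        and cont_snd: "continuous_on (?B \<times> ?B) (\<lambda>p. \<phi> (snd p))"
        by (rule continuous_on_compose2[OF cont]; auto intro!: continuous_intros)+
      have contG: "continuous_on (?B \<times> ?B) (\<lambda>p. G (fst p) (snd p))"
        unfolding G_def by (intro continuous_intros cont_fst cont_snd)
      have contE: "continuous_on (?B \<times> ?B) (\<lambda>p. E (fst p))" "continuous_on (?B \<times> ?B) (\<lambda>p. E (snd p))"
        unfolding E_def by (intro continuous_intros)+
      have "continuous_on (?B \<times> ?B) (\<lambda>p. of_real l * (1 - hinner (snd p) (fst p))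
          / (cnj (E (fst p)) * E (snd p) * G (fst p) (snd p)))"
        by (intro continuous_intros contE contG) (auto simp: E_nz G_nz)
      then have contS: "continuous_on (?B \<times> ?B) (\<lambda>p. 1 - S (fst p) (snd p))"
        by (rule continuous_on_eq) (auto simp: one_minus_S)
      show "continuous_on (?B \<times> ?B) h"
        unfolding h_def
        by (intro continuous_intros continuous_on_Ln_right_half_plane contE contG contS)
           (auto simp: ReE ReG S_lt intro!: Re_one_minus_pos hinner_ball_less_1
             simp del: minus_complex.sel one_complex.sel)
      show "(0, 0) \<in> ?B \<times> ?B" by simp
      show "(z, w) \<in> ?B \<times> ?B" using zw by simp
      show "h (0, 0) = 0"
      proof -
        have z0: "(0 :: complex ^ 'n) \<in> ?B" by simp
        have "\<phi> 0 = d" using \<phi>[OF z0] by simp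
        then have G0: "G 0 0 = of_real (1 - (norm d)\<^sup>2)" by (simp add: G_def hinner_self)
        have pos: "1 - (norm d)\<^sup>2 > 0" using d by (simp add: power_less_one_iff)
        have "1 - S 0 0 = of_real (l / (1 - (norm d)\<^sup>2))"
          using one_minus_S[OF z0 z0] by (simp add: G0 E_def)
        then have "Ln (1 - S 0 0) = of_real (ln (l / (1 - (norm d)\<^sup>2)))"
          using pos l by (simp only: Ln_of_real divide_pos_pos)
        moreover have "Ln (G 0 0) = of_real (ln (1 - (norm d)\<^sup>2))"
          unfolding G0 using pos by (rule Ln_of_real)
        ultimately show ?thesis
          using pos l by (simp add: h_def E_def ln_div)
      qed
      fix p assume "p \<in> ?B \<times> ?B"
      then obtain x y where p: "p = (x, y)" and x: "x \<in> ?B" and y: "y \<in> ?B" by auto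
      have nz: "1 - hinner y x \<noteq> 0" by (rule one_minus_hinner_nonzero[OF y x])
      have S_nz: "1 - S x y \<noteq> 0" using S_lt[OF x y] by force
      have "exp (cnj (Ln (E x))) = cnj (E x)" using E_nz[OF x] by (simp flip: exp_cnj)
      moreover have "exp (of_real (ln l)) = (of_real l :: complex)"
        using l by (simp add: exp_of_real)
      ultimately have "exp (h p) = (1 - hinner y x) * of_real l / E y / cnj (E x) / G x y / (1 - S x y)"
        using nz S_nz E_nz[OF y] G_nz[OF x y] by (simp add: h_def p exp_diff exp_add)
      also have "\<dots> = 1"
        unfolding one_minus_S[OF x y] using nz l E_nz[OF x] E_nz[OF y] G_nz[OF x y] by simp
      finally show "exp (h p) = 1" .
    qed
    then show ?thesis by (simp add: h_def algebra_simps)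
  qed

  \<comment> \<open>The constant |\<alpha>|^2 l^(-\<gamma>), where the power of \<open>l\<close>
    appears on multiplying \<open>Ln_eq\<close> by -\<gamma> and exponentiating; its square root is
    the norm bound.\<close>
  define m where "m = (norm \<alpha>)\<^sup>2 * exp (- \<gamma> * ln l)"
  have m: "m \<ge> 0" by (simp add: m_def)
  define k where "k z w = cnj (\<alpha> * ball_kernel \<gamma> c z) * cnj (cnj (\<alpha> * ball_kernel \<gamma> c w))
    * ball_kernel \<gamma> (\<phi> z) (\<phi> w)" for z w
  have factor: "of_real m * ball_kernel \<gamma> z w = k z w * (1 - S z w) powr (- of_real \<gamma>)"
    if zw: "z \<in> ?B" "w \<in> ?B" for z w
  proof -
    let ?g = "- of_real \<gamma> :: complex"
    have S_nz: "1 - S z w \<noteq> 0" using S_lt[OF zw] by force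
    have "of_real m * ball_kernel \<gamma> z w
        = (\<alpha> * cnj \<alpha>) * (exp (?g * of_real (ln l)) * exp (?g * Ln (1 - hinner w z)))"
      unfolding m_def of_real_mult complex_norm_square ball_kernel_exp[OF zw]
      by (simp flip: exp_of_real add: mult_ac)
    also have "exp (?g * of_real (ln l)) * exp (?g * Ln (1 - hinner w z))
        = exp (?g * (Ln (1 - hinner w z) + of_real (ln l)))"
      by (simp add: exp_add[symmetric] algebra_simps)
    also have "\<dots> = exp (?g * cnj (Ln (E z))) * exp (?g * Ln (E w)) * exp (?g * Ln (G z w)) * exp (?g * Ln (1 - S z w))"
      unfolding Ln_eq[OF zw] distrib_left exp_add by (simp only: mult_ac)
    also have "exp (?g * cnj (Ln (E z))) = cnj (ball_kernel \<gamma> c z)"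
      by (simp add: ball_kernel_exp[OF c zw(1)] E_def exp_cnj)
    also have "exp (?g * Ln (E w)) = ball_kernel \<gamma> c w"
      by (simp add: ball_kernel_exp[OF c zw(2)] E_def)
    also have "exp (?g * Ln (G z w)) = ball_kernel \<gamma> (\<phi> z) (\<phi> w)"
      by (simp add: ball_kernel_exp[OF \<phi>_ball[OF zw(1)] \<phi>_ball[OF zw(2)]] G_def)
    also have "exp (?g * Ln (1 - S z w)) = (1 - S z w) powr ?g"
      using S_nz by (simp add: powr_def)
    finally show ?thesis by (simp add: k_def mult_ac)
  qed
  have psd_k: "psd_on ?B k"
  proof -
    have lt: "norm (hinner (\<phi> w) (\<phi> z)) < 1" if "z \<in> ?B" "w \<in> ?B" for z w
      using hinner_ball_less_1 \<phi>_ball that by blast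
    from psd_on_one_minus_powr[OF psd_on_hinner lt \<gamma>]
    have "psd_on ?B (\<lambda>z w. ball_kernel \<gamma> (\<phi> z) (\<phi> w))"
      by (rule psd_on_cong) (use \<phi>_ball in \<open>auto simp: ball_kernel_def\<close>)
    from psd_on_rank_one_mult[OF this, of "\<lambda>z. cnj (\<alpha> * ball_kernel \<gamma> c z)"]
    show ?thesis unfolding k_def .
  qed
  \<comment> \<open>By \<open>factor\<close> this product is
    \<open>of_real m * ball_kernel \<gamma> z w - k z w\<close>.\<close>
  have "psd_on ?B (\<lambda>z w. k z w * ((1 - S z w) powr (- of_real \<gamma>) - 1))"
    by (intro psd_on_mult psd_k psd_on_one_minus_powr_diff psd_S S_lt \<gamma>)
  then have "psd_on ?B (\<lambda>z w. of_real ((sqrt m)\<^sup>2) * ball_kernel \<gamma> z w - k z w)"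
    by (rule psd_on_cong) (use m factor in \<open>simp add: right_diff_distrib\<close>)
  then show thesis
    unfolding k_def by (intro that[of "sqrt m"]) (simp_all add: m)
qed

section \<open>Operators of a linear fractional pair\<close>

lemma conj_transpose_conj_transpose [simp]: "conj_transpose (conj_transpose A) = A"
  by (simp add: conj_transpose_def vec_eq_iff)

text \<open>One operator of the pair suffices: exchanging \<open>c\<close> with \<open>d\<close>,
  \<open>f\<close> with \<open>g\<close>, \<open>\<phi>\<close> with \<open>\<psi>\<close>,
  \<open>A\<close> with its conjugate transpose and \<open>\<alpha>\<close> with
  \<open>cnj \<alpha>\<close> gives the other.\<close>

lemma weighted_comp_kernel_and_bounded:
  fixes \<phi> \<psi> :: "complex ^ 'n \<Rightarrow> complex ^ 'n" and A :: "complex ^ 'n ^ 'n"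
  assumes \<gamma>: "\<gamma> > 0"
    and H: "reproducing_kernel_hilbert_space unit_ball H ip (ball_kernel \<gamma>)"
    and c: "c \<in> unit_ball" and d: "d \<in> unit_ball"
    and \<phi>_ball: "\<And>z. z \<in> unit_ball \<Longrightarrow> \<phi> z \<in> unit_ball" and \<phi>_cont: "continuous_on unit_ball \<phi>"
    and \<psi>_ball: "\<And>z. z \<in> unit_ball \<Longrightarrow> \<psi> z \<in> unit_ball"
    and \<phi>: "\<And>z. z \<in> unit_ball \<Longrightarrow> \<phi> z = (1 / (1 - hinner z c)) *s (d + A *v z)"
    and \<psi>: "\<And>z. z \<in> unit_ball \<Longrightarrow> \<psi> z = (1 / (1 - hinner z d)) *s (c + conj_transpose A *v z)"
    and f: "\<And>z. z \<in> unit_ball \<Longrightarrow> f z = \<alpha> * ball_kernel \<gamma> c z"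
    and g: "\<And>z. z \<in> unit_ball \<Longrightarrow> g z = cnj \<alpha> * ball_kernel \<gamma> d z"
  shows "\<And>z. z \<in> unit_ball \<Longrightarrow>
      weighted_comp g \<psi> (ball_kernel \<gamma> z) = (\<lambda>w. cnj (f z) * ball_kernel \<gamma> (\<phi> z) w)"
    and "bounded_operator_on H ip (weighted_comp g \<psi>)"
proof -
  interpret reproducing_kernel_hilbert_space unit_ball H ip "ball_kernel \<gamma>" by (rule H)
  have \<phi>0: "\<phi> 0 = d" using \<phi>[of 0] by simp
  show kernel: "weighted_comp g \<psi> (ball_kernel \<gamma> z) = (\<lambda>w. cnj (f z) * ball_kernel \<gamma> (\<phi> z) w)"
    if z: "z \<in> unit_ball" for z
  proof
    fix w :: "complex ^ 'n"
    show "weighted_comp g \<psi> (ball_kernel \<gamma> z) w = cnj (f z) * ball_kernel \<gamma> (\<phi> z) w"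
    proof (cases "w \<in> unit_ball")
      case True
      have "(1 - hinner w (\<phi> 0)) * (1 - hinner (\<psi> w) z) = (1 - hinner c z) * (1 - hinner w (\<phi> z))"
        if "z \<in> unit_ball" for z
        unfolding \<phi>0
        by (rule product_identity_if_linear_fractional_pair[OF c d that True \<phi>[OF that] \<psi>[OF True]])
      then have "ball_kernel \<gamma> d w * ball_kernel \<gamma> z (\<psi> w) = ball_kernel \<gamma> z c * ball_kernel \<gamma> (\<phi> z) w"
        using ball_kernel_product_iff[of \<gamma> w "\<psi> w" c \<phi>] \<gamma> True c \<psi>_ball \<phi>_ball \<phi>_cont z
        unfolding \<phi>0 by blast
      moreover have "cnj (f z) = cnj \<alpha> * ball_kernel \<gamma> z c"
        by (simp only: f[OF z] complex_cnj_mult cnj_ball_kernel[OF c z])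
      ultimately show ?thesis
        using True by (simp only: weighted_comp_def g if_True mult.assoc)
    qed (simp add: weighted_comp_def ball_kernel_def)
  qed
  obtain M where "M \<ge> 0" and M: "psd_on unit_ball (\<lambda>z w. of_real (M\<^sup>2) * ball_kernel \<gamma> z w
       - cnj (\<alpha> * ball_kernel \<gamma> c z) * cnj (cnj (\<alpha> * ball_kernel \<gamma> c w)) * ball_kernel \<gamma> (\<phi> z) (\<phi> w))"
    by (rule psd_on_weighted_ball_kernel[OF \<gamma> c d \<phi>_ball \<phi>_cont \<phi>])
  show "bounded_operator_on H ip (weighted_comp g \<psi>)"
  proof (rule bounded_weighted_composition[of _ g \<psi> "\<lambda>z. cnj (f z)" \<phi> M])
    show "weighted_comp g \<psi> h x = (if x \<in> unit_ball then g x * h (\<psi> x) else 0)" for h x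
      by (simp add: weighted_comp_def)
    show "psd_on unit_ball (\<lambda>z w. of_real (M\<^sup>2) * ball_kernel \<gamma> z w
       - cnj (f z) * cnj (cnj (f w)) * ball_kernel \<gamma> (\<phi> z) (\<phi> w))"
      by (rule psd_on_cong[OF M]) (simp add: f)
  qed (use kernel \<psi>_ball \<phi>_ball \<open>M \<ge> 0\<close> in blast)+
qed

text \<open>The kernel at 0 is the constant 1 on the ball, and its image takes the value
  \<open>g 0\<close> at 0.\<close>

lemma nonzero_weighted_comp:
  assumes H: "reproducing_kernel_hilbert_space unit_ball H ip (ball_kernel \<gamma>)"
    and \<psi>: "\<psi> 0 \<in> unit_ball" and g: "g 0 \<noteq> 0"
  shows "nonzero_operator_on H (weighted_comp g \<psi>)"
  unfolding nonzero_operator_on_def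
proof
  show "ball_kernel \<gamma> 0 \<in> H"
    by (rule reproducing_kernel_hilbert_space.kernel_closed[OF H]) simp
  have "weighted_comp g \<psi> (ball_kernel \<gamma> 0) 0 \<noteq> 0"
    using assms by (simp add: weighted_comp_def ball_kernel_at_zero)
  then show "weighted_comp g \<psi> (ball_kernel \<gamma> 0) \<noteq> (\<lambda>_. 0)" by auto
qed

lemma linear_fractional_onI:
  fixes \<phi> :: "complex ^ 'n \<Rightarrow> complex ^ 'n"
  assumes "c \<in> unit_ball" "\<And>z. z \<in> unit_ball \<Longrightarrow> \<phi> z = (1 / (1 - hinner z c)) *s (d + A *v z)"
  shows "linear_fractional_on \<phi> unit_ball"
  unfolding linear_fractional_on_def
proof (intro exI ballI)
  fix z :: "complex ^ 'n" assume z: "z \<in> unit_ball"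
  show "hinner z (- c) + 1 \<noteq> 0 \<and> \<phi> z = (1 / (hinner z (- c) + 1)) *s (A *v z + d)"
    using assms(2)[OF z] one_minus_hinner_nonzero[OF z assms(1)]
    by (simp add: hinner_minus_right add.commute)
qed

section \<open>The two implications of the equivalence\<close>

lemma adjoint_pair_imp_linear_fractional_pair:
  fixes \<phi> \<psi> :: "complex ^ 'n \<Rightarrow> complex ^ 'n"
  assumes \<gamma>: "\<gamma> > 0"
    and H: "reproducing_kernel_hilbert_space unit_ball H ip (ball_kernel \<gamma>)"
    and \<phi>: "\<And>z. z \<in> unit_ball \<Longrightarrow> \<phi> z \<in> unit_ball" "continuous_on unit_ball \<phi>"
    and \<psi>: "\<And>z. z \<in> unit_ball \<Longrightarrow> \<psi> z \<in> unit_ball"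
    and pair: "nonzero_bounded_adjoint_pair H ip (weighted_comp g \<psi>) (weighted_comp f \<phi>)"
  shows "\<exists>(A :: complex ^ 'n ^ 'n) \<alpha>. \<alpha> \<noteq> 0 \<and>
      (\<forall>z\<in>unit_ball. \<phi> z = (1 / (1 - hinner z (\<psi> 0))) *s (\<phi> 0 + A *v z)) \<and>
      (\<forall>z\<in>unit_ball. \<psi> z = (1 / (1 - hinner z (\<phi> 0))) *s (\<psi> 0 + conj_transpose A *v z)) \<and>
      (\<forall>z\<in>unit_ball. f z = \<alpha> * ball_kernel \<gamma> (\<psi> 0) z) \<and>
      (\<forall>z\<in>unit_ball. g z = cnj \<alpha> * ball_kernel \<gamma> (\<phi> 0) z)"
proof -
  interpret reproducing_kernel_hilbert_space unit_ball H ip "ball_kernel \<gamma>" by (rule H)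
  let ?B = "unit_ball :: (complex ^ 'n) set"
  let ?T = "weighted_comp g \<psi>" and ?S = "weighted_comp f \<phi>"
  have T: "\<And>h. h \<in> H \<Longrightarrow> ?T h \<in> H" and S: "\<And>h. h \<in> H \<Longrightarrow> ?S h \<in> H"
    and adj: "\<And>h k. h \<in> H \<Longrightarrow> k \<in> H \<Longrightarrow> ip (?T h) k = ip h (?S k)"
    and S_nz: "nonzero_operator_on H ?S"
    using pair by (auto simp: nonzero_bounded_adjoint_pair_def bounded_operator_on_def is_adjoint_on_def)
  have 0: "0 \<in> ?B" by simp
  have ident: "g w * ball_kernel \<gamma> z (\<psi> w) = cnj (f z) * ball_kernel \<gamma> (\<phi> z) w"
    if z: "z \<in> ?B" and w: "w \<in> ?B" for z w
  proof -
    have K: "ball_kernel \<gamma> z \<in> H" "ball_kernel \<gamma> w \<in> H" using z w kernel_closed by auto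
    have "g w * ball_kernel \<gamma> z (\<psi> w) = ?T (ball_kernel \<gamma> z) w"
      using w by (simp add: weighted_comp_def)
    also have "\<dots> = ip (?T (ball_kernel \<gamma> z)) (ball_kernel \<gamma> w)"
      using reproducing[OF T[OF K(1)] w] by simp
    also have "\<dots> = ip (ball_kernel \<gamma> z) (?S (ball_kernel \<gamma> w))" by (rule adj[OF K])
    also have "\<dots> = cnj (?S (ball_kernel \<gamma> w) z)" by (rule ip_kernel_left[OF S[OF K(2)] z])
    also have "\<dots> = cnj (f z) * ball_kernel \<gamma> (\<phi> z) w"
      using z by (simp only: weighted_comp_def if_True complex_cnj_mult cnj_ball_kernel[OF w \<phi>(1)[OF z]])
    finally show ?thesis .
  qed
  \<comment> \<open>Every kernel function takes the value 1 at the origin, so \<alpha> can only be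
    \<open>f 0\<close>.\<close>
  define \<alpha> where "\<alpha> = f 0"
  have g: "g w = cnj \<alpha> * ball_kernel \<gamma> (\<phi> 0) w" if "w \<in> ?B" for w
    using ident[OF 0 that] \<psi>[OF that] by (simp add: ball_kernel_at_zero \<alpha>_def)
  have "g 0 = cnj \<alpha>" using g[OF 0] \<phi>(1)[OF 0] by (simp add: ball_kernel_at_zero)
  then have cnj_f: "cnj (f z) = cnj \<alpha> * ball_kernel \<gamma> z (\<psi> 0)" if "z \<in> ?B" for z
    using ident[OF that 0] \<phi>(1)[OF that] by (simp add: ball_kernel_at_zero)
  have f: "f z = \<alpha> * ball_kernel \<gamma> (\<psi> 0) z" if "z \<in> ?B" for z
    using arg_cong[OF cnj_f[OF that], of cnj]
    by (simp only: complex_cnj_mult complex_cnj_cnj cnj_ball_kernel[OF that \<psi>[OF 0]])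
  have \<alpha>: "\<alpha> \<noteq> 0"
  proof
    assume "\<alpha> = 0"
    then have "?S h = (\<lambda>_. 0)" for h by (auto simp: weighted_comp_def f)
    then show False using S_nz by (simp add: nonzero_operator_on_def)
  qed
  have product: "(1 - hinner w (\<phi> 0)) * (1 - hinner (\<psi> w) z) = (1 - hinner (\<psi> 0) z) * (1 - hinner w (\<phi> z))"
    if z: "z \<in> ?B" and w: "w \<in> ?B" for z w
  proof -
    \<comment> \<open>The common factor \<open>cnj \<alpha>\<close> cancels from
      \<open>ident\<close>. The identity is needed for all \<open>z\<close> at the fixed
      \<open>w\<close>, so \<open>z\<close> is rebound here.\<close>
    have "ball_kernel \<gamma> (\<phi> 0) w * ball_kernel \<gamma> z (\<psi> w) = ball_kernel \<gamma> z (\<psi> 0) * ball_kernel \<gamma> (\<phi> z) w"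
      if "z \<in> ?B" for z
      using ident[OF that w] \<alpha> by (simp add: g[OF w] cnj_f[OF that])
    then show ?thesis
      using ball_kernel_product_iff[of \<gamma> w "\<psi> w" "\<psi> 0" \<phi>] \<gamma> w z \<psi> 0 \<phi> by blast
  qed
  show ?thesis
    using linear_fractional_pair_if_product_identity[of "\<psi> 0" "\<phi> 0" \<psi> \<phi>, OF \<psi>[OF 0] \<phi>(1)[OF 0] product]
      \<alpha> f g by blast
qed

text \<open>The positivity estimate is used once for each operator. Adjointness is then tested with
  kernel functions in the first argument, where the action of the operator is explicit.\<close>

lemma linear_fractional_pair_imp_adjoint_pair:
  fixes \<phi> \<psi> :: "complex ^ 'n \<Rightarrow> complex ^ 'n" and A :: "complex ^ 'n ^ 'n"
  assumes \<gamma>: "\<gamma> > 0"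
    and H: "reproducing_kernel_hilbert_space unit_ball H ip (ball_kernel \<gamma>)"
    and c: "c \<in> unit_ball" and d: "d \<in> unit_ball" and \<alpha>: "\<alpha> \<noteq> 0"
    and \<phi>_ball: "\<And>z. z \<in> unit_ball \<Longrightarrow> \<phi> z \<in> unit_ball" and \<phi>_cont: "continuous_on unit_ball \<phi>"
    and \<psi>_ball: "\<And>z. z \<in> unit_ball \<Longrightarrow> \<psi> z \<in> unit_ball" and \<psi>_cont: "continuous_on unit_ball \<psi>"
    and \<phi>: "\<And>z. z \<in> unit_ball \<Longrightarrow> \<phi> z = (1 / (1 - hinner z c)) *s (d + A *v z)"
    and \<psi>: "\<And>z. z \<in> unit_ball \<Longrightarrow> \<psi> z = (1 / (1 - hinner z d)) *s (c + conj_transpose A *v z)"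
    and f: "\<And>z. z \<in> unit_ball \<Longrightarrow> f z = \<alpha> * ball_kernel \<gamma> c z"
    and g: "\<And>z. z \<in> unit_ball \<Longrightarrow> g z = cnj \<alpha> * ball_kernel \<gamma> d z"
  shows "nonzero_bounded_adjoint_pair H ip (weighted_comp g \<psi>) (weighted_comp f \<phi>)"
proof -
  interpret reproducing_kernel_hilbert_space unit_ball H ip "ball_kernel \<gamma>" by (rule H)
  have 0: "(0 :: complex ^ 'n) \<in> unit_ball" by simp
  have T: "bounded_operator_on H ip (weighted_comp g \<psi>)"
    by (rule weighted_comp_kernel_and_bounded(2)[OF \<gamma> H c d \<phi>_ball \<phi>_cont \<psi>_ball \<phi> \<psi> f g])
  have S: "bounded_operator_on H ip (weighted_comp f \<phi>)"
    \<comment> \<open>The roles of the two maps are exchanged; the double conjugate transpose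
      simplifies back to \<open>A\<close>.\<close>
    by (rule weighted_comp_kernel_and_bounded(2)[where \<alpha> = "cnj \<alpha>" and A = "conj_transpose A",
          OF \<gamma> H d c \<psi>_ball \<psi>_cont \<phi>_ball \<psi>])
       (simp_all add: \<phi> f g)
  have "is_adjoint_on H ip (weighted_comp g \<psi>) (weighted_comp f \<phi>)"
  proof (rule is_adjoint_onI[OF T S])
    fix z :: "complex ^ 'n" and k assume z: "z \<in> unit_ball" and k: "k \<in> H"
    have "ip (weighted_comp g \<psi> (ball_kernel \<gamma> z)) k = cnj (f z) * cnj (k (\<phi> z))"
    proof -
      have "weighted_comp g \<psi> (ball_kernel \<gamma> z) = (\<lambda>w. cnj (f z) * ball_kernel \<gamma> (\<phi> z) w)"
        by (rule weighted_comp_kernel_and_bounded(1)[OF \<gamma> H c d \<phi>_ball \<phi>_cont \<psi>_ball \<phi> \<psi> f g z])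
      then show ?thesis
        using ip_scale[OF kernel_closed[OF \<phi>_ball[OF z]] k] ip_kernel_left[OF k \<phi>_ball[OF z]]
        by simp
    qed
    also have "\<dots> = cnj (weighted_comp f \<phi> k z)"
      using z by (simp add: weighted_comp_def)
    finally show "ip (weighted_comp g \<psi> (ball_kernel \<gamma> z)) k = cnj (weighted_comp f \<phi> k z)" .
  qed
  moreover have "nonzero_operator_on H (weighted_comp g \<psi>)"
    by (rule nonzero_weighted_comp[of H ip \<gamma> \<psi> g, OF H \<psi>_ball[OF 0]]) (simp add: g[OF 0] ball_kernel_at_zero(2)[OF d] \<alpha>)
  moreover have "nonzero_operator_on H (weighted_comp f \<phi>)"
    by (rule nonzero_weighted_comp[of H ip \<gamma> \<phi> f, OF H \<phi>_ball[OF 0]]) (simp add: f[OF 0] ball_kernel_at_zero(2)[OF c] \<alpha>)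
  ultimately show ?thesis
    using T S by (simp add: nonzero_bounded_adjoint_pair_def)
qed

theorem theorem5p2:
  fixes \<gamma> :: real
    and H :: "(complex ^ 'n \<Rightarrow> complex) set"
    and ip :: "(complex ^ 'n \<Rightarrow> complex) \<Rightarrow> (complex ^ 'n \<Rightarrow> complex) \<Rightarrow> complex"
    and f g :: "complex ^ 'n \<Rightarrow> complex"
    and \<phi> \<psi> :: "complex ^ 'n \<Rightarrow> complex ^ 'n"
  assumes "\<gamma> > 0"
    and "is_H_gamma \<gamma> H ip"
    and "analytic_fun_on f unit_ball"
    and "analytic_fun_on g unit_ball"
    and "analytic_self_map_on \<phi> unit_ball"
    and "analytic_self_map_on \<psi> unit_ball"
  shows
    "(nonzero_bounded_adjoint_pair H ip (weighted_comp g \<psi>) (weighted_comp f \<phi>) \<longleftrightarrow>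
       (\<exists>c d. \<exists>(A :: complex ^ 'n ^ 'n) (\<alpha> :: complex).
          c \<in> unit_ball \<and> d \<in> unit_ball \<and> \<alpha> \<noteq> 0 \<and>
          (\<forall>z\<in>unit_ball. \<phi> z = (1 / (1 - hinner z c)) *s (d + A *v z)) \<and>
          (\<forall>z\<in>unit_ball. \<psi> z = (1 / (1 - hinner z d)) *s (c + conj_transpose A *v z)) \<and>
          (\<forall>z\<in>unit_ball. f z = \<alpha> * ball_kernel \<gamma> c z \<and>
                          f z = \<alpha> * ball_kernel \<gamma> (\<psi> 0) z) \<and>
          (\<forall>z\<in>unit_ball. g z = cnj \<alpha> * ball_kernel \<gamma> d z \<and>
                          g z = cnj \<alpha> * ball_kernel \<gamma> (\<phi> 0) z))) \<and>
     (nonzero_bounded_adjoint_pair H ip (weighted_comp g \<psi>) (weighted_comp f \<phi>) \<longrightarrow>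
       linear_fractional_on \<phi> unit_ball \<and> linear_fractional_on \<psi> unit_ball)"
    (is "(?pair \<longleftrightarrow> ?form) \<and> (?pair \<longrightarrow> ?lf)")
proof -
  have H: "reproducing_kernel_hilbert_space unit_ball H ip (ball_kernel \<gamma>)"
    using assms(2) by (simp add: is_H_gamma_def)
  have \<phi>: "\<And>z. z \<in> unit_ball \<Longrightarrow> \<phi> z \<in> unit_ball" "continuous_on unit_ball \<phi>"
    and \<psi>: "\<And>z. z \<in> unit_ball \<Longrightarrow> \<psi> z \<in> unit_ball" "continuous_on unit_ball \<psi>"
    using assms(5,6) analytic_self_map_on_imp_continuous_on
    unfolding analytic_self_map_on_def by blast+
  have 0: "(0 :: complex ^ 'n) \<in> unit_ball" by simp
  have forward: "?form \<and> ?lf" if pair: ?pair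
  proof -
    obtain A :: "complex ^ 'n ^ 'n" and \<alpha> where A: "\<alpha> \<noteq> 0"
      "\<And>z. z \<in> unit_ball \<Longrightarrow> \<phi> z = (1 / (1 - hinner z (\<psi> 0))) *s (\<phi> 0 + A *v z)"
      "\<And>z. z \<in> unit_ball \<Longrightarrow> \<psi> z = (1 / (1 - hinner z (\<phi> 0))) *s (\<psi> 0 + conj_transpose A *v z)"
      "\<And>z. z \<in> unit_ball \<Longrightarrow> f z = \<alpha> * ball_kernel \<gamma> (\<psi> 0) z"
      "\<And>z. z \<in> unit_ball \<Longrightarrow> g z = cnj \<alpha> * ball_kernel \<gamma> (\<phi> 0) z"
      using adjoint_pair_imp_linear_fractional_pair[OF assms(1) H \<phi> \<psi>(1) pair] by blast
    \<comment> \<open>The witnesses are forced: at \<open>z = 0\<close> the two formulas give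
      \<open>\<phi> 0 = d\<close> and \<open>\<psi> 0 = c\<close>. With this choice the two
      descriptions of \<open>f\<close>, and those of \<open>g\<close>, coincide.\<close>
    have ?form
      by (rule exI[of _ "\<psi> 0"], rule exI[of _ "\<phi> 0"], rule exI[of _ A], rule exI[of _ \<alpha>])
         (intro conjI ballI \<phi>(1) \<psi>(1) 0 A)
    moreover have "linear_fractional_on \<phi> unit_ball"
      by (rule linear_fractional_onI[OF \<psi>(1)[OF 0] A(2)])
    moreover have "linear_fractional_on \<psi> unit_ball"
      by (rule linear_fractional_onI[OF \<phi>(1)[OF 0] A(3)])
    ultimately show ?thesis by blast
  qed
  have backward: ?pair if form: ?form
  proof -
    obtain c d :: "complex ^ 'n" and A :: "complex ^ 'n ^ 'n" and \<alpha> where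
      c: "c \<in> unit_ball" and d: "d \<in> unit_ball" and \<alpha>: "\<alpha> \<noteq> 0"
      and A: "\<And>z. z \<in> unit_ball \<Longrightarrow> \<phi> z = (1 / (1 - hinner z c)) *s (d + A *v z)"
        "\<And>z. z \<in> unit_ball \<Longrightarrow> \<psi> z = (1 / (1 - hinner z d)) *s (c + conj_transpose A *v z)"
        "\<And>z. z \<in> unit_ball \<Longrightarrow> f z = \<alpha> * ball_kernel \<gamma> c z"
        "\<And>z. z \<in> unit_ball \<Longrightarrow> g z = cnj \<alpha> * ball_kernel \<gamma> d z"
      using form by blast
    show ?pair
      by (rule linear_fractional_pair_imp_adjoint_pair[OF assms(1) H c d \<alpha> \<phi> \<psi> A])
  qed
  from forward backward show ?thesis by blast
qed

end
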